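(* Let $n\ge1$. (i) If $N>n(n-1)/2$, then $\kappa(n,N)\le1+\frac{n(n-1)}{2N-n(n-1)}\bigl(\kappa(n)+1\bigr)$. (ii) If $N\ge n$, then $\kappa(n,N)\ge\exp\Bigl(\frac{n-1}{2\lceil N/n\rceil}\Bigr)\ge1+\frac{n(n-1)}{2(N+n)}$. (iii) If $N\ge n\ge m$, then $\kappa(n,N;m)\le1+c_{\pi,s+}(n,\ell_1^m)\frac{2mn}{N}\le1+\frac{2mn\,\kappa(n)}{N}$. (iv) If $N\ge n\ge m$, then $\kappa(n,N;m)\ge\exp\Bigl(\frac{m-1}{2\lceil N/n\rceil}\Bigr)\ge1+\frac{(m-1)n}{2(N+n)}$.
   Context: For a finite set $S$, $\ell_1(S)$ is $\mathbb{R}^S$ with the $\ell_1$-norm, ordered coordinatewise (positive = nonnegative coordinates); $\ell_1^m=\ell_1(\{1,\dots,m\})$, with standard basis $(e_i)$. Tensor notation: $E^{\otimes n}$ is the algebraic tensor power, $E^{\vee n}$ the symmetric tensors, $x^{\otimes n}:=x\otimes\cdots\otimes x$, $x_1\vee\cdots\vee x_n:=\frac1{n!}\sum_{\sigma\in\mathfrak S_n}x_{\sigma(1)}\otimes\cdots\otimes x_{\sigma(n)}$; $\|\mathbf{x}\|_{\pi,E}:=\inf\{\sum_k|a_k|\prod_i\|x_{ik}\| : \mathbf{x}=\sum_k a_kx_{1k}\otimes\cdots\otimes x_{nk}\}$ and, for $E=\ell_1(S)$, $\|\mathbf{x}\|_{\pi s+,E}:=\inf\{\sum_k|a_k|\,\|x_k\|^n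 : \mathbf{x}=\sum_k a_k x_k^{\otimes n},\ x_k\ge0\}$ (finite sums); $c_{\pi,s+}(n,E):=\sup\{\|\mathbf{x}\|_{\pi s+,E}/\|\mathbf{x}\|_{\pi,E}:0\ne\mathbf{x}\in E^{\vee n}\}$. $\kappa(n):=\|e_1\vee\cdots\vee e_n\|_{\pi s+,\ell_1^n}$. Signed measures on $S^n$ are identified with $\ell_1(S)^{\otimes n}$ via $\delta_{(s_1,\dots,s_n)}\leftrightarrow\delta_{s_1}\otimes\cdots\otimes\delta_{s_n}$. For $N\ge n$, $\chi_{n,N}$ is the distribution on $[N]^n$ of $(Y_1,\dots,Y_n)$ where $(Y_1,\dots,Y_N)$ is a uniformly random permutation of $[N]=\{1,\dots,N\}$, and $\kappa(n,N):=\|\chi_{n,N}\|_{\pi s+,\ell_1^N}$. For a set $S$ with $|S|=m$ and $\mathbf{x}=(x_1,\dots,x_N)\in S^N$, $\mu_{\mathbf x}$ is the distribution on $S^n$ of $(x_{Y_1},\dots,x_{Y_n})$ (drawing $n$ of $x_1,\dots,x_N$ without replacement), and $\kappa(n,N;m):=\max_{\mathbf x\in S^N}\|\mu_{\mathbf x}\|_{\pi s+,\ell_1(S)}$ (which depends only on $m$). *)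

theory Defs
  imports Complex_Main "HOL-Library.FuncSet" "HOL-Combinatorics.Permutations"
begin

text \<open>Vectors of l1(S), S a finite set: functions 'a => real vanishing outside S.
  Tensors in l1(S)^(tensor n): functions on length-n lists over S (i.e. on S^n),
  vanishing elsewhere (finite dimension: algebraic tensor power = all such functions;
  signed measures on S^n identified with tensors via point masses).\<close>

definition l1 :: "'a set \<Rightarrow> ('a \<Rightarrow> real) set" where
  "l1 S = {x. \<forall>s. x s \<noteq> 0 \<longrightarrow> s \<in> S}"

definition l1norm :: "'a set \<Rightarrow> ('a \<Rightarrow> real) \<Rightarrow> real" where
  "l1norm S x = (\<Sum>s\<in>S. \<bar>x s\<bar>)"

definition tspace :: "'a set \<Rightarrow> nat \<Rightarrow> ('a list \<Rightarrow> real) set" where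
  "tspace S n = {T. \<forall>ys. T ys \<noteq> 0 \<longrightarrow> length ys = n \<and> set ys \<subseteq> S}"

definition tprod :: "'a set \<Rightarrow> nat \<Rightarrow> (nat \<Rightarrow> 'a \<Rightarrow> real) \<Rightarrow> 'a list \<Rightarrow> real" where
  "tprod S n xs = (\<lambda>ys. if length ys = n \<and> set ys \<subseteq> S then (\<Prod>i<n. xs i (ys ! i)) else 0)"

definition tpow :: "'a set \<Rightarrow> nat \<Rightarrow> ('a \<Rightarrow> real) \<Rightarrow> 'a list \<Rightarrow> real" where
  "tpow S n x = tprod S n (\<lambda>_. x)"

definition sym_prod :: "'a set \<Rightarrow> nat \<Rightarrow> (nat \<Rightarrow> 'a \<Rightarrow> real) \<Rightarrow> 'a list \<Rightarrow> real" where
  "sym_prod S n xs = (\<lambda>ys. (1 / fact n) *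
      (\<Sum>\<sigma>\<in>{\<sigma>. \<sigma> permutes {..<n}}. tprod S n (\<lambda>i. xs (\<sigma> i)) ys))"

definition symmetric_tensor :: "nat \<Rightarrow> ('a list \<Rightarrow> real) \<Rightarrow> bool" where
  "symmetric_tensor n T \<longleftrightarrow>
     (\<forall>ys \<sigma>. \<sigma> permutes {..<n} \<longrightarrow> length ys = n \<longrightarrow> T (map (\<lambda>i. ys ! \<sigma> i) [0..<n]) = T ys)"

definition pi_norm :: "'a set \<Rightarrow> nat \<Rightarrow> ('a list \<Rightarrow> real) \<Rightarrow> real" where
  "pi_norm S n T = Inf {(\<Sum>k<K. \<bar>a k\<bar> * (\<Prod>i<n. l1norm S (xs k i))) | (K::nat) a xs.
       (\<forall>k<K. \<forall>i<n. xs k i \<in> l1 S) \<and> T = (\<lambda>ys. \<Sum>k<K. a k * tprod S n (xs k) ys)}"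

definition pis_norm :: "'a set \<Rightarrow> nat \<Rightarrow> ('a list \<Rightarrow> real) \<Rightarrow> real" where
  "pis_norm S n T = Inf {(\<Sum>k<K. \<bar>a k\<bar> * l1norm S (x k) ^ n) | (K::nat) a x.
       (\<forall>k<K. x k \<in> l1 S \<and> (\<forall>s. x k s \<ge> 0)) \<and> T = (\<lambda>ys. \<Sum>k<K. a k * tpow S n (x k) ys)}"

definition c_pis :: "nat \<Rightarrow> 'a set \<Rightarrow> real" where
  "c_pis n S = Sup {pis_norm S n T / pi_norm S n T | T.
       T \<in> tspace S n \<and> symmetric_tensor n T \<and> T \<noteq> (\<lambda>_. 0)}"

definition ebasis :: "nat \<Rightarrow> nat \<Rightarrow> real" where
  "ebasis j = (\<lambda>s. if s = j then 1 else 0)"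

definition kappa :: "nat \<Rightarrow> real" where
  "kappa n = pis_norm {1..n} n (sym_prod {1..n} n (\<lambda>i. ebasis (i + 1)))"

definition chi :: "nat \<Rightarrow> nat \<Rightarrow> nat list \<Rightarrow> real" where
  "chi n N = (\<lambda>ys. real (card {\<sigma>. \<sigma> permutes {1..N} \<and> map \<sigma> [1..<n+1] = ys}) / fact N)"

definition kappa2 :: "nat \<Rightarrow> nat \<Rightarrow> real" where
  "kappa2 n N = pis_norm {1..N} n (chi n N)"

definition mu :: "nat \<Rightarrow> nat \<Rightarrow> (nat \<Rightarrow> 'a) \<Rightarrow> 'a list \<Rightarrow> real" where
  "mu n N x = (\<lambda>ys. real (card {\<sigma>. \<sigma> permutes {1..N} \<and> map (x \<circ> \<sigma>) [1..<n+1] = ys}) / fact N)"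

text \<open>kappa(n,N;m), with S = {1..m} (it depends only on |S| = m).\<close>
definition kappa3 :: "nat \<Rightarrow> nat \<Rightarrow> nat \<Rightarrow> real" where
  "kappa3 n N m = Max ((\<lambda>x. pis_norm {1..m} n (mu n N x)) ` ({1..N} \<rightarrow>\<^sub>E {1..m}))"

end

theory Submission
  imports Defs "HOL-Analysis.Infinite_Products"
begin

text \<open>
  A bound on a symmetric tensor follows from writing it as a combination of push-forwards of
  \<open>e\<^sub>1 \<or> \<dots> \<or> e\<^sub>n\<close>, since the norm is contractive under push-forward; polarization makes
  \<open>e\<^sub>1 \<or> \<dots> \<or> e\<^sub>n\<close> representable. Part (i) conditions an i.i.d. uniform sample on having no
  coincidences. Part (iii) is the Diaconis--Freedman bound \<open>2 m n / N\<close> on the \<open>\<ell>\<^sub>1\<close> distance between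
  sampling without and with replacement: the likelihood ratio of the latter to the former is at
  least \<open>1 - \<Sum>\<^sub>j c\<^sub>j / N\<^sub>j\<close> pointwise, and the colour count \<open>c\<^sub>j\<close> has mean \<open>n N\<^sub>j / N\<close>.
  For part (iv) the tensor is evaluated at a word of type \<open>c = (n - m + 1, 1, \<dots>, 1)\<close>, where
  \<open>x\<^sup>\<otimes>\<^sup>n\<close> is at most \<open>\<Prod>\<^sub>j (c\<^sub>j / n)\<close> to the powers \<open>c\<^sub>j\<close> for \<open>x\<close> in the simplex, and which is more
  likely without replacement if the fibre sizes are nearly proportional to \<open>c\<close>. Part (ii) is part (iv)
  with \<open>m = n\<close>, as \<open>\<mu>\<^sub>x\<close> is a push-forward of \<open>\<chi>\<close>.
\<close>

declare One_nat_def [simp del]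

section \<open>Words over an alphabet and sums of products over words\<close>

definition words :: "'a set \<Rightarrow> nat \<Rightarrow> 'a list set" where
  "words S n = {ys. length ys = n \<and> set ys \<subseteq> S}"

lemma finite_words [simp]: "finite S \<Longrightarrow> finite (words S n)"
  unfolding words_def using finite_lists_length_eq[of S n] by (simp add: conj_commute)

lemma words_Suc: "words S (Suc n) = (\<lambda>(s, ys). s # ys) ` (S \<times> words S n)"
  by (force simp: words_def length_Suc_conv image_iff)

lemma sum_words_Suc:
  "(\<Sum>ys\<in>words S (Suc n). g ys) = (\<Sum>s\<in>S. \<Sum>ys\<in>words S n. g (s # ys))"
proof -
  have "inj_on (\<lambda>(s, ys). s # ys) (S \<times> words S n)"
    by (auto simp: inj_on_def)
  from sum.reindex[OF this] show ?thesis
    unfolding words_Suc sum.cartesian_product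
    by (simp add: o_def case_prod_unfold)
qed

text \<open>Distributivity. With absolute values inside, it makes the \<open>l1\<close> norm
  multiplicative on elementary tensors; for a probability vector it shows that the tensor power has
  total mass one.\<close>

lemma sum_words_prod:
  fixes g :: "nat \<Rightarrow> 'a \<Rightarrow> real"
  shows "(\<Sum>ys\<in>words S n. \<Prod>i<n. g i (ys ! i)) = (\<Prod>i<n. \<Sum>s\<in>S. g i s)"
proof (induction n arbitrary: g)
  case 0
  have "words S 0 = {[]}" by (auto simp: words_def)
  then show ?case by simp
next
  case (Suc n)
  show ?case
    by (simp add: sum_words_Suc prod.lessThan_Suc_shift Suc.IH[of "\<lambda>i. g (Suc i)"]
        flip: sum_distrib_left sum_distrib_right del: prod.lessThan_Suc)
qed

lemma tpow_eq: "tpow S n x ys = (if ys \<in> words S n then prod_list (map x ys) else 0)"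
proof -
  have "(\<Prod>i<length ys. x (ys ! i)) = prod_list (map x ys)" for ys :: "'a list"
    by (induction ys) (simp_all add: prod.lessThan_Suc_shift del: prod.lessThan_Suc)
  then show ?thesis
    by (auto simp: tpow_def tprod_def words_def)
qed

lemma l1norm_nonneg [simp]: "0 \<le> l1norm S x"
  by (simp add: l1norm_def sum_nonneg)

section \<open>The set of representation costs\<close>

definition pis_sums :: "'a set \<Rightarrow> nat \<Rightarrow> ('a list \<Rightarrow> real) \<Rightarrow> real set" where
  "pis_sums S n T = {(\<Sum>k<K. \<bar>a k\<bar> * l1norm S (x k) ^ n) | (K::nat) a x.
       (\<forall>k<K. x k \<in> l1 S \<and> (\<forall>s. x k s \<ge> 0)) \<and> T = (\<lambda>ys. \<Sum>k<K. a k * tpow S n (x k) ys)}"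

lemma pis_sumsE:
  fixes T :: "'a list \<Rightarrow> real"
  assumes "v \<in> pis_sums S n T"
  obtains K :: nat and a :: "nat \<Rightarrow> real" and x :: "nat \<Rightarrow> 'a \<Rightarrow> real"
  where "v = (\<Sum>k<K. \<bar>a k\<bar> * l1norm S (x k) ^ n)"
    "\<forall>k<K. x k \<in> l1 S \<and> (\<forall>s. x k s \<ge> 0)" "T = (\<lambda>ys. \<Sum>k<K. a k * tpow S n (x k) ys)"
  using assms unfolding pis_sums_def by blast

lemma pis_norm_eq_Inf: "pis_norm S n T = Inf (pis_sums S n T)"
  by (simp add: pis_norm_def pis_sums_def)

lemma pis_sums_nonneg: "v \<in> pis_sums S n T \<Longrightarrow> 0 \<le> v"
  by (auto simp: pis_sums_def intro!: sum_nonneg)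

lemma bdd_below_pis_sums [simp]: "bdd_below (pis_sums S n T)"
  by (meson bdd_belowI pis_sums_nonneg)

lemma pis_sums_zero: "0 \<in> pis_sums S n (\<lambda>_. 0)"
  unfolding pis_sums_def
  by (rule CollectI, rule exI[of _ 0]) auto

lemma pis_sums_tpow:
  assumes "x \<in> l1 S" "\<And>s. x s \<ge> 0"
  shows "l1norm S x ^ n \<in> pis_sums S n (tpow S n x)"
  unfolding pis_sums_def
  by (rule CollectI, rule exI[of _ 1], rule exI[of _ "\<lambda>_. 1"], rule exI[of _ "\<lambda>_. x"])
     (use assms in auto)

lemma sum_lessThan_append:
  fixes f g :: "nat \<Rightarrow> real"
  shows "(\<Sum>k<K + L. if k < K then f k else g (k - K)) = (\<Sum>k<K. f k) + (\<Sum>k<L. g k)"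
  by (induction L) auto

lemma pis_sums_add:
  assumes "v \<in> pis_sums S n T" "w \<in> pis_sums S n U"
  shows "v + w \<in> pis_sums S n (\<lambda>ys. T ys + U ys)"
proof -
  obtain K :: nat and a x where 1: "v = (\<Sum>k<K. \<bar>a k\<bar> * l1norm S (x k) ^ n)"
    "\<forall>k<K. x k \<in> l1 S \<and> (\<forall>s. x k s \<ge> 0)" "T = (\<lambda>ys. \<Sum>k<K. a k * tpow S n (x k) ys)"
    by (rule pis_sumsE[OF assms(1)]) blast
  obtain L :: nat and b y where 2: "w = (\<Sum>k<L. \<bar>b k\<bar> * l1norm S (y k) ^ n)"
    "\<forall>k<L. y k \<in> l1 S \<and> (\<forall>s. y k s \<ge> 0)" "U = (\<lambda>ys. \<Sum>k<L. b k * tpow S n (y k) ys)"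
    by (rule pis_sumsE[OF assms(2)]) blast
  \<comment> \<open>Concatenation of the two representations, the second one shifted by
    \<open>K\<close>.\<close>
  define c where "c k = (if k < K then a k else b (k - K))" for k
  define z where "z k = (if k < K then x k else y (k - K))" for k
  have "v + w = (\<Sum>k<K+L. \<bar>c k\<bar> * l1norm S (z k) ^ n)"
    unfolding 1 2 sum_lessThan_append[symmetric] by (rule sum.cong) (auto simp: c_def z_def)
  moreover have "\<forall>k<K+L. z k \<in> l1 S \<and> (\<forall>s. z k s \<ge> 0)"
    using 1 2 by (auto simp: z_def)
  moreover have "(\<lambda>ys. T ys + U ys) = (\<lambda>ys. \<Sum>k<K+L. c k * tpow S n (z k) ys)"
    unfolding 1 2 sum_lessThan_append[symmetric]
    by (rule ext, rule sum.cong) (auto simp: c_def z_def)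
  ultimately show ?thesis
    unfolding pis_sums_def by blast
qed

lemma pis_sums_scale:
  assumes "v \<in> pis_sums S n T"
  shows "\<bar>c\<bar> * v \<in> pis_sums S n (\<lambda>ys. c * T ys)"
proof -
  obtain K :: nat and a x where 1: "v = (\<Sum>k<K. \<bar>a k\<bar> * l1norm S (x k) ^ n)"
    "\<forall>k<K. x k \<in> l1 S \<and> (\<forall>s. x k s \<ge> 0)" "T = (\<lambda>ys. \<Sum>k<K. a k * tpow S n (x k) ys)"
    by (rule pis_sumsE[OF assms(1)]) blast
  show ?thesis
    unfolding pis_sums_def
    by (rule CollectI, rule exI[of _ K], rule exI[of _ "\<lambda>k. c * a k"], rule exI[of _ x])
       (use 1 in \<open>auto simp: sum_distrib_left abs_mult mult.assoc\<close>)
qed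

text \<open>Image of a signed measure on words under letterwise application of \<open>f\<close>,
  that is, the tensor power of the linear map sending the point mass at \<open>s\<close> to the one
  at \<open>f s\<close>.\<close>

definition push :: "('a \<Rightarrow> 'b) \<Rightarrow> 'a set \<Rightarrow> nat \<Rightarrow> ('a list \<Rightarrow> real) \<Rightarrow> 'b list \<Rightarrow> real" where
  "push f S n T zs = (\<Sum>ws\<in>{ws \<in> words S n. map f ws = zs}. T ws)"

text \<open>Multiplying out the sums over fibres; this is why the push-forward of a tensor power is
  the tensor power of the pushed vector.\<close>

lemma prod_list_sum_fibres:
  fixes x :: "'a \<Rightarrow> real"
  assumes "finite S"
  shows "prod_list (map (\<lambda>z. \<Sum>s\<in>{s\<in>S. f s = z}. x s) zs)
       = (\<Sum>ws\<in>{ws \<in> words S (length zs). map f ws = zs}. prod_list (map x ws))"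
proof (induction zs)
  case Nil
  have "{ws \<in> words S 0. map f ws = []} = {[]}" by (auto simp: words_def)
  then show ?case by simp
next
  case (Cons z zs)
  let ?A = "{s\<in>S. f s = z}" and ?B = "{ws \<in> words S (length zs). map f ws = zs}"
  have eq: "{ws \<in> words S (length (z # zs)). map f ws = z # zs} = (\<lambda>(s, ys). s # ys) ` (?A \<times> ?B)"
    by (auto simp: words_Suc)
  have "inj_on (\<lambda>(s, ys). s # ys) (?A \<times> ?B)" by (auto simp: inj_on_def)
  from sum.reindex[OF this, of "\<lambda>ws. prod_list (map x ws)"]
  have "(\<Sum>ws\<in>{ws \<in> words S (length (z # zs)). map f ws = z # zs}. prod_list (map x ws))
     = (\<Sum>s\<in>?A. \<Sum>ws\<in>?B. x s * prod_list (map x ws))"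
    unfolding eq sum.cartesian_product by (simp add: o_def case_prod_unfold)
  then show ?case
    using Cons by (simp add: sum_product)
qed

text \<open>A representation is pushed forward vector by vector. Nonnegative vectors stay
  nonnegative and keep their norm, so the cost is literally unchanged.\<close>

lemma pis_sums_push:
  assumes "v \<in> pis_sums S n T" "finite S" "finite S'" "f ` S \<subseteq> S'"
  shows "v \<in> pis_sums S' n (push f S n T)"
proof -
  obtain K :: nat and a x where 1: "v = (\<Sum>k<K. \<bar>a k\<bar> * l1norm S (x k) ^ n)"
    "\<forall>k<K. x k \<in> l1 S \<and> (\<forall>s. x k s \<ge> 0)" "T = (\<lambda>ys. \<Sum>k<K. a k * tpow S n (x k) ys)"
    by (rule pis_sumsE[OF assms(1)]) blast
  define y where "y k = (\<lambda>z. \<Sum>s\<in>{s\<in>S. f s = z}. x k s)" for k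
  have l1: "\<forall>k<K. y k \<in> l1 S' \<and> (\<forall>s. y k s \<ge> 0)"
  proof (intro allI impI conjI)
    fix k assume k: "k < K"
    show "y k s \<ge> 0" for s using 1 k by (auto simp: y_def intro!: sum_nonneg)
    have "y k s = 0" if "s \<notin> S'" for s
    proof -
      have "{t\<in>S. f t = s} = {}" using that assms by auto
      then show ?thesis by (simp only: y_def sum.empty)
    qed
    then show "y k \<in> l1 S'" unfolding l1_def by blast
  qed
  \<comment> \<open>Nonnegativity gives equality: there is no cancellation inside a fibre.\<close>
  have norm: "l1norm S' (y k) = l1norm S (x k)" if "k < K" for k
  proof -
    have "l1norm S' (y k) = (\<Sum>z\<in>S'. \<Sum>s\<in>{s\<in>S. f s = z}. x k s)"
      using l1 that by (simp add: l1norm_def y_def)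
    also have "\<dots> = (\<Sum>s\<in>S. x k s)"
      by (rule sum.group) (use assms in auto)
    finally show ?thesis using 1 that by (simp add: l1norm_def)
  qed
  have tp: "push f S n (tpow S n (x k)) zs = tpow S' n (y k) zs" for k zs
  proof (cases "zs \<in> words S' n")
    case True
    then have "length zs = n" by (simp add: words_def)
    then have "tpow S' n (y k) zs = (\<Sum>ws\<in>{ws \<in> words S n. map f ws = zs}. prod_list (map (x k) ws))"
      using True prod_list_sum_fibres[OF assms(2), where f = f and x = "x k" and zs = zs] by (simp add: tpow_eq y_def)
    also have "\<dots> = push f S n (tpow S n (x k)) zs"
      unfolding push_def by (rule sum.cong) (auto simp: tpow_eq)
    finally show ?thesis ..
  next
    case False
    then have "{ws \<in> words S n. map f ws = zs} = {}"
      using assms(4) by (fastforce simp: words_def)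
    then show ?thesis using False by (simp only: push_def tpow_eq) simp
  qed
  have "push f S n T = (\<lambda>zs. \<Sum>k<K. a k * push f S n (tpow S n (x k)) zs)"
    unfolding 1 push_def sum_distrib_left by (rule ext, rule sum.swap)
  then have "push f S n T = (\<lambda>zs. \<Sum>k<K. a k * tpow S' n (y k) zs)"
    by (simp add: tp)
  moreover have "v = (\<Sum>k<K. \<bar>a k\<bar> * l1norm S' (y k) ^ n)"
    using norm 1 by simp
  ultimately show ?thesis using l1 unfolding pis_sums_def by blast
qed

section \<open>Upper bounds that include representability\<close>

text \<open>Nonemptiness is carried along because a real \<open>Inf\<close> over the empty set has
  no useful value, and such a bound would not survive addition or push-forward.\<close>

definition pis_le :: "'a set \<Rightarrow> nat \<Rightarrow> ('a list \<Rightarrow> real) \<Rightarrow> real \<Rightarrow> bool" where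
  "pis_le S n T B \<longleftrightarrow> pis_sums S n T \<noteq> {} \<and> pis_norm S n T \<le> B"

text \<open>The epsilon form merges both conjuncts, so closure properties of \<open>pis_sums\<close>
  transfer directly to \<open>pis_le\<close>.\<close>

lemma pis_le_iff: "pis_le S n T B \<longleftrightarrow> (\<forall>e>0. \<exists>v\<in>pis_sums S n T. v < B + e)"
proof
  assume L: "pis_le S n T B"
  show "\<forall>e>0. \<exists>v\<in>pis_sums S n T. v < B + e"
  proof (intro allI impI)
    fix e :: real assume "e > 0"
    then have "Inf (pis_sums S n T) < B + e"
      using L by (simp add: pis_le_def pis_norm_eq_Inf)
    then show "\<exists>v\<in>pis_sums S n T. v < B + e"
      using L cInf_lessD unfolding pis_le_def by blast
  qed
next
  assume R: "\<forall>e>0. \<exists>v\<in>pis_sums S n T. v < B + e"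
  have "pis_norm S n T \<le> B"
  proof (rule field_le_epsilon)
    fix e :: real assume "e > 0"
    then obtain v where "v \<in> pis_sums S n T" "v < B + e" using R by blast
    then show "pis_norm S n T \<le> B + e"
      using cInf_lower[of v "pis_sums S n T"] by (simp add: pis_norm_eq_Inf)
  qed
  then show "pis_le S n T B"
    using R zero_less_one unfolding pis_le_def by blast
qed

lemma pis_leI: "v \<in> pis_sums S n T \<Longrightarrow> v \<le> B \<Longrightarrow> pis_le S n T B"
  unfolding pis_le_iff by force

lemma pis_le_norm: "pis_le S n T B \<Longrightarrow> pis_norm S n T \<le> B"
  by (simp add: pis_le_def)

lemma pis_norm_nonneg: "pis_le S n T B \<Longrightarrow> 0 \<le> pis_norm S n T"
  unfolding pis_le_def pis_norm_eq_Inf by (meson cInf_greatest pis_sums_nonneg)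

lemma pis_le_self: "pis_le S n T B \<Longrightarrow> pis_le S n T (pis_norm S n T)"
  by (simp add: pis_le_def)

lemma pis_le_add:
  assumes "pis_le S n T A" "pis_le S n U B"
  shows "pis_le S n (\<lambda>ys. T ys + U ys) (A + B)"
  unfolding pis_le_iff
proof (intro allI impI)
  fix e :: real assume "e > 0"
  then have "e / 2 > 0" by simp
  then obtain v w where "v \<in> pis_sums S n T" "v < A + e/2" "w \<in> pis_sums S n U" "w < B + e/2"
    using assms unfolding pis_le_iff by blast
  then show "\<exists>v\<in>pis_sums S n (\<lambda>ys. T ys + U ys). v < A + B + e"
    by (intro bexI[of _ "v + w"] pis_sums_add) auto
qed

lemma pis_le_scale:
  assumes "pis_le S n T A"
  shows "pis_le S n (\<lambda>ys. c * T ys) (\<bar>c\<bar> * A)"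
\<comment> \<open>The tolerance \<open>e / \<bar>c\<bar>\<close> requires \<open>c\<close> nonzero;
  the zero tensor has the empty representation.\<close>
proof (cases "c = 0")
  case True
  then show ?thesis using pis_leI[OF pis_sums_zero, of 0] by simp
next
  case False
  show ?thesis
    unfolding pis_le_iff
  proof (intro allI impI)
    fix e :: real assume "e > 0"
    then have "e / \<bar>c\<bar> > 0" using False by simp
    then obtain v where v: "v \<in> pis_sums S n T" "v < A + e / \<bar>c\<bar>"
      using assms unfolding pis_le_iff by blast
    then have "\<bar>c\<bar> * v < \<bar>c\<bar> * (A + e / \<bar>c\<bar>)" using False by simp
    then have "\<bar>c\<bar> * v < \<bar>c\<bar> * A + e" using False by (simp add: distrib_left)
    then show "\<exists>v\<in>pis_sums S n (\<lambda>ys. c * T ys). v < \<bar>c\<bar> * A + e"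
      using pis_sums_scale[OF v(1)] by blast
  qed
qed

lemma pis_le_sum:
  assumes "finite I" "\<And>i. i \<in> I \<Longrightarrow> pis_le S n (T i) (B i)"
  shows "pis_le S n (\<lambda>ys. \<Sum>i\<in>I. c i * T i ys) (\<Sum>i\<in>I. \<bar>c i\<bar> * B i)"
  using assms
proof (induction I)
  case empty
  then show ?case using pis_leI[OF pis_sums_zero, of 0] by simp
next
  case (insert i I)
  have "pis_le S n (T i) (B i)"
    using insert.prems by blast
  moreover have "pis_le S n (\<lambda>ys. \<Sum>j\<in>I. c j * T j ys) (\<Sum>j\<in>I. \<bar>c j\<bar> * B j)"
    using insert.IH insert.prems by blast
  ultimately have "pis_le S n (\<lambda>ys. c i * T i ys + (\<Sum>j\<in>I. c j * T j ys)) (\<bar>c i\<bar> * B i + (\<Sum>j\<in>I. \<bar>c j\<bar> * B j))"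
    by (rule pis_le_add[OF pis_le_scale])
  then show ?case
    by (simp only: sum.insert[OF insert.hyps])
qed

lemma pis_le_push:
  assumes "pis_le S n T B" "finite S" "finite S'" "f ` S \<subseteq> S'"
  shows "pis_le S' n (push f S n T) B"
  unfolding pis_le_iff
  by (meson assms pis_sums_push pis_le_iff)

section \<open>The projective norm over \<open>l1\<close> is the \<open>l1\<close> norm on
  words\<close>

lemma tprod_point_mass:
  assumes "w \<in> words S n"
  shows "tprod S n (\<lambda>i s. if s = w ! i then 1 else 0) ys = (if ys = w then 1 else 0)"
proof (cases "ys \<in> words S n")
  case True
  have "(\<Prod>i<n. if ys ! i = w ! i then 1 else 0 :: real) = (if ys = w then 1 else 0)"
  proof (cases "ys = w")
    case False
    then obtain i where "i < n" "ys ! i \<noteq> w ! i"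
      using True assms by (auto simp: words_def list_eq_iff_nth_eq)
    then show ?thesis using False by (simp add: prod_zero_iff) blast
  qed simp
  then show ?thesis using True by (simp add: tprod_def words_def)
next
  case False
  then show ?thesis using assms by (auto simp: tprod_def words_def)
qed

lemma tspace_eq_0: "T \<in> tspace S n \<Longrightarrow> ys \<notin> words S n \<Longrightarrow> T ys = 0"
  by (auto simp: tspace_def words_def)

text \<open>The triangle inequality and multiplicativity bound every representation from below; the
  expansion into point masses attains this bound, so the infimum is a minimum.\<close>

lemma pi_norm_eq:
  assumes S: "finite S" and T: "T \<in> tspace S n"
  shows "pi_norm S n T = (\<Sum>ys\<in>words S n. \<bar>T ys\<bar>)"
proof -
  let ?V = "{(\<Sum>k<K. \<bar>a k\<bar> * (\<Prod>i<n. l1norm S (xs k i))) | (K::nat) a xs.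
       (\<forall>k<K. \<forall>i<n. xs k i \<in> l1 S) \<and> T = (\<lambda>ys. \<Sum>k<K. a k * tprod S n (xs k) ys)}"
  have lower: "(\<Sum>ys\<in>words S n. \<bar>T ys\<bar>) \<le> v" if "v \<in> ?V" for v
  proof -
    obtain K :: nat and a xs where v: "v = (\<Sum>k<K. \<bar>a k\<bar> * (\<Prod>i<n. l1norm S (xs k i)))"
      "T = (\<lambda>ys. \<Sum>k<K. a k * tprod S n (xs k) ys)"
      using \<open>v \<in> ?V\<close> by blast
    have "(\<Sum>ys\<in>words S n. \<bar>T ys\<bar>) \<le> (\<Sum>ys\<in>words S n. \<Sum>k<K. \<bar>a k\<bar> * (\<Prod>i<n. \<bar>xs k i (ys ! i)\<bar>))"
      unfolding v(2)
    proof (rule sum_mono, rule order_trans[OF sum_abs], rule sum_mono)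
      fix ys k assume "ys \<in> words S n"
      then show "\<bar>a k * tprod S n (xs k) ys\<bar> \<le> \<bar>a k\<bar> * (\<Prod>i<n. \<bar>xs k i (ys ! i)\<bar>)"
        by (simp add: tprod_def words_def abs_mult abs_prod)
    qed
    also have "\<dots> = (\<Sum>k<K. \<bar>a k\<bar> * (\<Sum>ys\<in>words S n. \<Prod>i<n. \<bar>xs k i (ys ! i)\<bar>))"
      unfolding sum_distrib_left by (rule sum.swap)
    also have "\<dots> = v"
      unfolding v(1) by (simp add: sum_words_prod[of "\<lambda>i s. \<bar>xs _ i s\<bar>"] l1norm_def)
    finally show ?thesis .
  qed
  have mem: "(\<Sum>ys\<in>words S n. \<bar>T ys\<bar>) \<in> ?V"
  proof -
    \<comment> \<open>Representations are indexed by initial segments of the naturals, so the words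
      are enumerated first.\<close>
    obtain h where h: "bij_betw h {0..<card (words S n)} (words S n)"
      using ex_bij_betw_nat_finite[OF finite_words[OF S]] by blast
    define d where "d w = (\<lambda>i s. if s = w ! i then 1 else 0 :: real)" for w :: "'a list"
    have l1n: "l1norm S (d w i) = 1" and l1m: "d w i \<in> l1 S" if "w \<in> words S n" "i < n" for w i
    proof -
      have "w ! i \<in> S" using that by (auto simp: words_def)
      then show "l1norm S (d w i) = 1" "d w i \<in> l1 S"
        using S by (auto simp: l1norm_def d_def l1_def if_distrib[of abs] cong: if_cong)
    qed
    have hw: "h k \<in> words S n" if "k < card (words S n)" for k
      using h that by (auto simp: bij_betw_def)
    have re: "(\<Sum>k<card (words S n). g (h k)) = (\<Sum>w\<in>words S n. g w)" for g :: "'a list \<Rightarrow> real"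
      using sum.reindex_bij_betw[OF h, of g] by (simp add: atLeast0LessThan)
    have "T = (\<lambda>ys. \<Sum>k<card (words S n). T (h k) * tprod S n (d (h k)) ys)"
    proof
      fix ys
      have "(\<Sum>k<card (words S n). T (h k) * tprod S n (d (h k)) ys)
          = (\<Sum>w\<in>words S n. T w * tprod S n (d w) ys)" by (rule re)
      also have "\<dots> = (\<Sum>w\<in>words S n. if ys = w then T w else 0)"
        by (rule sum.cong) (auto simp: d_def tprod_point_mass)
      also have "\<dots> = T ys"
        using S tspace_eq_0[OF T] by (simp add: sum.delta')
      finally show "T ys = (\<Sum>k<card (words S n). T (h k) * tprod S n (d (h k)) ys)" by (rule sym)
    qed
    moreover have "(\<Sum>ys\<in>words S n. \<bar>T ys\<bar>) =
        (\<Sum>k<card (words S n). \<bar>T (h k)\<bar> * (\<Prod>i<n. l1norm S (d (h k) i)))"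
      unfolding re[symmetric] using l1n hw by simp
    moreover have "\<forall>k<card (words S n). \<forall>i<n. d (h k) i \<in> l1 S"
      using l1m hw by blast
    ultimately show ?thesis
      by (intro CollectI exI[of _ "card (words S n)"] exI[of _ "\<lambda>k. T (h k)"] exI[of _ "\<lambda>k. d (h k)"]) auto
  qed
  show ?thesis
    unfolding pi_norm_def
    using cInf_eq_minimum[OF mem lower] by simp
qed

section \<open>Symmetric tensors\<close>

text \<open>The word whose point mass is the term of \<open>\<sigma>\<close> in the symmetrization.
  The shift by one arises because permutations act on \<open>{..<n}\<close> while the letters are
  \<open>{1..n}\<close>.\<close>

definition perm_word :: "nat \<Rightarrow> (nat \<Rightarrow> nat) \<Rightarrow> nat list" where
  "perm_word n \<sigma> = map (\<lambda>i. \<sigma> i + 1) [0..<n]"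

abbreviation kappa_tensor :: "nat \<Rightarrow> nat list \<Rightarrow> real" where
  "kappa_tensor n \<equiv> sym_prod {1..n} n (\<lambda>i. ebasis (i + 1))"

lemma perm_word_in_words: "\<sigma> permutes {..<n} \<Longrightarrow> perm_word n \<sigma> \<in> words {1..n} n"
  using permutes_in_image[of \<sigma> "{..<n}"]
  by (simp add: perm_word_def words_def image_subset_iff Suc_le_eq flip: Suc_eq_plus1)

lemma kappa_tensor_eq:
  "kappa_tensor n ys = (1 / fact n) * (\<Sum>\<sigma>\<in>{\<sigma>. \<sigma> permutes {..<n}}. if ys = perm_word n \<sigma> then 1 else 0)"
proof -
  have "tprod {1..n} n (\<lambda>i. ebasis (\<sigma> i + 1)) ys = (if ys = perm_word n \<sigma> then 1 else 0)"
    if "\<sigma> permutes {..<n}" for \<sigma>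
  proof -
    have "tprod {1..n} n (\<lambda>i. ebasis (\<sigma> i + 1)) ys
        = tprod {1..n} n (\<lambda>i s. if s = perm_word n \<sigma> ! i then 1 else 0) ys"
      by (simp add: tprod_def ebasis_def perm_word_def)
    then show ?thesis
      by (simp add: tprod_point_mass[OF perm_word_in_words[OF that]])
  qed
  then show ?thesis by (simp add: sym_prod_def)
qed

text \<open>A word of length \<open>n\<close> that uses all \<open>n\<close> letters repeats none,
  so exactly one permutation can be read off from it; a word missing a letter comes from
  none.\<close>

lemma sum_perm_word:
  assumes "ys \<in> words {1..n} n"
  shows "(\<Sum>\<sigma>\<in>{\<sigma>. \<sigma> permutes {..<n}}. if ys = perm_word n \<sigma> then 1 else 0 :: real)
       = (if {1..n} \<subseteq> set ys then 1 else 0)"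
proof (cases "{1..n} \<subseteq> set ys")
  case True
  have ys: "length ys = n" "set ys = {1..n}" using True assms by (auto simp: words_def)
  then have dist: "distinct ys" by (simp add: card_distinct)
  \<comment> \<open>The permutation read off from \<open>ys\<close>; it is the identity outside
    \<open>{..<n}\<close>, as \<open>permutes\<close> demands.\<close>
  define \<tau> where "\<tau> i = (if i < n then ys ! i - 1 else i)" for i
  have nth: "1 \<le> ys ! i \<and> ys ! i \<le> n" if "i < n" for i
    using nth_mem[of i ys] ys that by simp
  have "inj_on \<tau> {..<n}"
  proof (rule inj_onI)
    fix i j assume ij: "i \<in> {..<n}" "j \<in> {..<n}" "\<tau> i = \<tau> j"
    then have "ys ! i = ys ! j" using nth[of i] nth[of j] by (simp add: \<tau>_def) linarith
    then show "i = j" using ij dist ys by (simp add: nth_eq_iff_index_eq)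
  qed
  moreover have "\<tau> ` {..<n} \<subseteq> {..<n}"
    using nth by (force simp: \<tau>_def)
  ultimately have "bij_betw \<tau> {..<n} {..<n}"
    by (simp add: bij_betw_def endo_inj_surj)
  then have perm: "\<tau> permutes {..<n}"
    by (rule bij_imp_permutes) (simp add: \<tau>_def)
  have "ys = perm_word n \<sigma> \<longleftrightarrow> \<sigma> = \<tau>" if "\<sigma> permutes {..<n}" for \<sigma>
  proof
    assume eq: "ys = perm_word n \<sigma>"
    show "\<sigma> = \<tau>"
    proof
      fix i show "\<sigma> i = \<tau> i"
        using permutes_not_in[OF that, of i] by (cases "i < n") (auto simp: \<tau>_def eq perm_word_def)
    qed
  next
    assume "\<sigma> = \<tau>"
    then show "ys = perm_word n \<sigma>"
      using ys nth by (auto simp: perm_word_def \<tau>_def intro!: nth_equalityI)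
  qed
  then have "(\<Sum>\<sigma>\<in>{\<sigma>. \<sigma> permutes {..<n}}. if ys = perm_word n \<sigma> then 1 else 0 :: real)
      = (\<Sum>\<sigma>\<in>{\<sigma>. \<sigma> permutes {..<n}}. if \<sigma> = \<tau> then 1 else 0)"
    by (intro sum.cong) auto
  then show ?thesis
    using True perm by (simp add: sum.delta finite_permutations)
next
  case False
  have "ys \<noteq> perm_word n \<sigma>" if "\<sigma> permutes {..<n}" for \<sigma>
  proof
    assume "ys = perm_word n \<sigma>"
    then have "set ys = Suc ` (\<sigma> ` {..<n})"
      by (auto simp: perm_word_def atLeast0LessThan)
    also have "\<dots> = Suc ` {..<n}" by (simp only: permutes_image[OF that])
    also have "\<dots> = {1..n}" by (simp add: image_Suc_lessThan)
    finally show False using False by simp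
  qed
  then show ?thesis using False by (auto intro!: sum.neutral)
qed

lemma sum_Pow_prod_compl:
  fixes g :: "'a \<Rightarrow> real"
  assumes "finite A"
  shows "(\<Sum>B\<in>Pow A. \<Prod>j\<in>A - B. g j) = (\<Prod>j\<in>A. 1 + g j)"
proof -
  have "(\<Prod>j\<in>A. 1 + g j) = (\<Sum>B\<in>Pow A. (\<Prod>j\<in>B. 1) * (\<Prod>j\<in>A - B. g j))"
    using prod_add[OF assms, of "\<lambda>_. 1" g] by simp
  then show ?thesis by simp
qed

text \<open>Polarization: inclusion--exclusion over the supports of the 0/1 vectors.\<close>

lemma kappa_tensor_polarization:
  "kappa_tensor n = (\<lambda>ys. \<Sum>A\<in>Pow {1..n}. (1 / fact n * (-1) ^ card ({1..n} - A)) *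
      tpow {1..n} n (\<lambda>s. if s \<in> A then 1 else 0) ys)"
proof
  fix ys
  show "kappa_tensor n ys = (\<Sum>A\<in>Pow {1..n}. (1 / fact n * (-1) ^ card ({1..n} - A)) *
      tpow {1..n} n (\<lambda>s. if s \<in> A then 1 else 0) ys)"
  proof (cases "ys \<in> words {1..n} n")
    case False
    then have "ys \<noteq> perm_word n \<sigma>" if "\<sigma> permutes {..<n}" for \<sigma>
      using perm_word_in_words that by blast
    then show ?thesis
      using False by (simp add: kappa_tensor_eq tpow_eq)
  next
    case True
    \<comment> \<open>With this \<open>g\<close> the product over the complement of \<open>A\<close>
      vanishes unless \<open>A\<close> contains every letter of \<open>ys\<close>, and is the sign
      otherwise. The alternating sum thus factors into terms \<open>1 + g j\<close>, each
      \<open>1\<close> if \<open>j\<close> occurs in \<open>ys\<close> and \<open>0\<close> if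
      not.\<close>
    define g where "g j = (if j \<in> set ys then 0 else -1 :: real)" for j :: nat
    have "(-1) ^ card ({1..n} - A) * prod_list (map (\<lambda>s. if s \<in> A then 1 else 0 :: real) ys)
        = (\<Prod>j\<in>{1..n} - A. g j)" if "A \<subseteq> {1..n}" for A
    proof (cases "set ys \<subseteq> A")
      case True
      then have "prod_list (map (\<lambda>s. if s \<in> A then 1 else 0 :: real) ys) = 1"
        by (induction ys) auto
      moreover have "(\<Prod>j\<in>{1..n} - A. g j) = (\<Prod>j\<in>{1..n} - A. -1)"
        using True by (intro prod.cong) (auto simp: g_def)
      ultimately show ?thesis by simp
    next
      case F: False
      then have "prod_list (map (\<lambda>s. if s \<in> A then 1 else 0 :: real) ys) = 0"
        by (auto simp: prod_list_zero_iff)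
      moreover have "(\<Prod>j\<in>{1..n} - A. g j) = 0"
        using F True by (intro prod_zero) (auto simp: g_def words_def)
      ultimately show ?thesis by simp
    qed
    then have "(\<Sum>A\<in>Pow {1..n}. (-1) ^ card ({1..n} - A) *
        prod_list (map (\<lambda>s. if s \<in> A then 1 else 0 :: real) ys)) = (\<Sum>A\<in>Pow {1..n}. \<Prod>j\<in>{1..n} - A. g j)"
      by (intro sum.cong) auto
    also have "\<dots> = (\<Prod>j\<in>{1..n}. 1 + g j)"
      by (rule sum_Pow_prod_compl) simp
    also have "\<dots> = (if {1..n} \<subseteq> set ys then 1 else 0)"
    proof (cases "{1..n} \<subseteq> set ys")
      case True
      then show ?thesis by (auto intro!: prod.neutral simp: g_def)
    next
      case False
      then show ?thesis by (auto intro!: prod_zero simp: g_def)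
    qed
    finally have *: "(\<Sum>A\<in>Pow {1..n}. (-1) ^ card ({1..n} - A) *
        prod_list (map (\<lambda>s. if s \<in> A then 1 else 0 :: real) ys)) = (if {1..n} \<subseteq> set ys then 1 else 0)" .
    have "kappa_tensor n ys = 1 / fact n * (if {1..n} \<subseteq> set ys then 1 else 0)"
      using True by (simp only: kappa_tensor_eq sum_perm_word)
    then show ?thesis
      using True by (simp only: *[symmetric] sum_distrib_left mult.assoc tpow_eq if_True)
  qed
qed

text \<open>Polarization supplies a representation with some bound \<open>B\<close>;
  \<open>pis_le_self\<close> then sharpens the bound to the norm itself, which is
  \<open>kappa n\<close>.\<close>

lemma pis_le_kappa_tensor: "pis_le {1..n} n (kappa_tensor n) (kappa n)"
proof -
  have "\<exists>B. pis_le {1..n} n (\<lambda>ys. \<Sum>A\<in>Pow {1..n}. (1 / fact n * (-1) ^ card ({1..n} - A)) *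
      tpow {1..n} n (\<lambda>s. if s \<in> A then 1 else 0) ys) B"
    by (rule exI, rule pis_le_sum, simp, rule pis_leI[OF pis_sums_tpow order_refl])
       (auto simp: l1_def)
  then show ?thesis
    unfolding kappa_def kappa_tensor_polarization[symmetric] using pis_le_self by blast
qed

lemma kappa_nonneg: "0 \<le> kappa n"
  using pis_norm_nonneg[OF pis_le_kappa_tensor] by (simp add: kappa_def)

section \<open>Symmetric tensors as combinations of push-forwards of the symmetrized basis
  word\<close>

lemma permute_list_eq_iff:
  assumes "\<sigma> permutes {..<n}" "length ys = n" "length zs = n"
  shows "permute_list \<sigma> ys = zs \<longleftrightarrow> ys = permute_list (inv \<sigma>) zs"
proof
  assume "permute_list \<sigma> ys = zs"
  then have "permute_list (inv \<sigma>) zs = permute_list (\<sigma> \<circ> inv \<sigma>) ys"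
    using permutes_inv[OF assms(1)] assms by (subst permute_list_compose) auto
  then show "ys = permute_list (inv \<sigma>) zs"
    using permutes_inv_o[OF assms(1)] by simp
next
  assume "ys = permute_list (inv \<sigma>) zs"
  then have "permute_list \<sigma> ys = permute_list (inv \<sigma> \<circ> \<sigma>) zs"
    using assms by (subst permute_list_compose) auto
  then show "permute_list \<sigma> ys = zs"
    using permutes_inv_o[OF assms(1)] by simp
qed

lemma symmetric_tensor_permute_list:
  "symmetric_tensor n T \<longleftrightarrow> (\<forall>ys \<sigma>. \<sigma> permutes {..<n} \<longrightarrow> length ys = n \<longrightarrow> T (permute_list \<sigma> ys) = T ys)"
  by (auto simp: symmetric_tensor_def permute_list_def)

text \<open>Relabelling \<open>i\<close> as the \<open>i\<close>-th entry of \<open>ys\<close> turns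
  the symmetric product of the basis vectors into that of the point masses at the entries of
  \<open>ys\<close>. The index \<open>i - 1\<close> appears because letters start at 1 and lists at
  0.\<close>

lemma push_kappa_tensor:
  assumes "length ys = n"
  shows "push (\<lambda>i. ys ! (i - 1)) {1..n} n (kappa_tensor n) zs
    = (1 / fact n) * (\<Sum>\<sigma>\<in>{\<sigma>. \<sigma> permutes {..<n}}. if permute_list \<sigma> ys = zs then 1 else 0)"
proof -
  let ?f = "\<lambda>i. ys ! (i - 1)" and ?P = "{\<sigma>. \<sigma> permutes {..<n}}"
  have mp: "map ?f (perm_word n \<sigma>) = permute_list \<sigma> ys" for \<sigma>
    using assms by (simp add: perm_word_def permute_list_def)
  have "push ?f {1..n} n (kappa_tensor n) zs
      = (1 / fact n) * (\<Sum>\<sigma>\<in>?P. \<Sum>ws\<in>{ws \<in> words {1..n} n. map ?f ws = zs}. if ws = perm_word n \<sigma> then 1 else 0)"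
    unfolding push_def kappa_tensor_eq sum_distrib_left[symmetric] by (subst sum.swap) simp
  also have "\<dots> = (1 / fact n) * (\<Sum>\<sigma>\<in>?P. if permute_list \<sigma> ys = zs then 1 else 0)"
    by (intro arg_cong[where f = "(*) _"] sum.cong refl)
       (use mp perm_word_in_words in \<open>auto simp: sum.delta\<close>)
  finally show ?thesis .
qed

text \<open>Write \<open>T\<close> as a sum of point masses and symmetrize: \<open>T\<close> is
  fixed, and each point mass becomes one of the push-forwards.\<close>

lemma symmetric_tensor_decomposition:
  assumes S: "finite S" and T: "T \<in> tspace S n" "symmetric_tensor n T"
  shows "T = (\<lambda>zs. \<Sum>ys\<in>words S n. T ys * push (\<lambda>i. ys ! (i - 1)) {1..n} n (kappa_tensor n) zs)"
proof
  fix zs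
  let ?P = "{\<sigma>. \<sigma> permutes {..<n}}"
  \<comment> \<open>For a fixed permutation only one word \<open>ys\<close> contributes, and
    symmetry gives \<open>T\<close> the same value there as at \<open>zs\<close>.\<close>
  have inner: "(\<Sum>ys\<in>words S n. T ys * (if permute_list \<sigma> ys = zs then 1 else 0)) = T zs"
    if \<sigma>: "\<sigma> permutes {..<n}" for \<sigma>
  proof (cases "zs \<in> words S n")
    case True
    let ?y = "permute_list (inv \<sigma>) zs"
    have len: "length zs = n" using True by (simp add: words_def)
    have y: "?y \<in> words S n"
      using True permutes_inv[OF \<sigma>] by (simp add: words_def set_permute_list)
    have "(\<Sum>ys\<in>words S n. T ys * (if permute_list \<sigma> ys = zs then 1 else 0))
        = (\<Sum>ys\<in>words S n. if ys = ?y then T ys else 0)"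
      using permute_list_eq_iff[OF \<sigma> _ len] by (intro sum.cong) (auto simp: words_def)
    also have "\<dots> = T ?y" using y S by (simp add: sum.delta)
    also have "\<dots> = T zs"
      using T(2) permutes_inv[OF \<sigma>] len unfolding symmetric_tensor_permute_list by blast
    finally show ?thesis .
  next
    case False
    have "permute_list \<sigma> ys \<noteq> zs" if "ys \<in> words S n" for ys
      using False that \<sigma> by (auto simp: words_def set_permute_list)
    then show ?thesis using False tspace_eq_0[OF T(1)] by simp
  qed
  have "(\<Sum>ys\<in>words S n. T ys * push (\<lambda>i. ys ! (i - 1)) {1..n} n (kappa_tensor n) zs)
      = (\<Sum>ys\<in>words S n. T ys * ((1 / fact n) * (\<Sum>\<sigma>\<in>?P. if permute_list \<sigma> ys = zs then 1 else 0)))"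
    by (intro sum.cong refl arg_cong[where f = "(*) _"] push_kappa_tensor) (simp add: words_def)
  also have "\<dots> = (1 / fact n) * (\<Sum>ys\<in>words S n. \<Sum>\<sigma>\<in>?P. T ys * (if permute_list \<sigma> ys = zs then 1 else 0))"
    by (simp only: sum_distrib_left mult.left_commute)
  also have "\<dots> = (1 / fact n) * (\<Sum>\<sigma>\<in>?P. \<Sum>ys\<in>words S n. T ys * (if permute_list \<sigma> ys = zs then 1 else 0))"
    by (subst sum.swap) (rule refl)
  also have "\<dots> = T zs"
    using inner by (simp add: card_permutations[OF refl])
  finally show "T zs = (\<Sum>ys\<in>words S n. T ys * push (\<lambda>i. ys ! (i - 1)) {1..n} n (kappa_tensor n) zs)" by (rule sym)
qed

text \<open>Each push-forward in the decomposition costs at most \<open>kappa n\<close>, so the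
  triangle inequality applies. In particular every symmetric tensor is representable by nonnegative
  vectors.\<close>

lemma pis_le_symmetric:
  assumes S: "finite S" and T: "T \<in> tspace S n" "symmetric_tensor n T"
  shows "pis_le S n T (kappa n * (\<Sum>ys\<in>words S n. \<bar>T ys\<bar>))"
proof -
  have "pis_le S n (push (\<lambda>i. ys ! (i - 1)) {1..n} n (kappa_tensor n)) (kappa n)"
    if "ys \<in> words S n" for ys
  proof (rule pis_le_push[OF pis_le_kappa_tensor])
    show "(\<lambda>i. ys ! (i - 1)) ` {1..n} \<subseteq> S"
    proof safe
      fix i assume "i \<in> {1..n}"
      then have "ys ! (i - 1) \<in> set ys" using that by (auto simp: words_def)
      then show "ys ! (i - 1) \<in> S" using that by (auto simp: words_def)
    qed
  qed (use S in auto)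
  then have "pis_le S n (\<lambda>zs. \<Sum>ys\<in>words S n. T ys * push (\<lambda>i. ys ! (i - 1)) {1..n} n (kappa_tensor n) zs)
      (\<Sum>ys\<in>words S n. \<bar>T ys\<bar> * kappa n)"
    using S by (intro pis_le_sum) auto
  then have "pis_le S n T (\<Sum>ys\<in>words S n. \<bar>T ys\<bar> * kappa n)"
    \<comment> \<open>The decomposition has \<open>T\<close> on both sides, so it is substituted at
      one chosen place only.\<close>
    by (rule ssubst[where P = "\<lambda>U. pis_le S n U _", OF symmetric_tensor_decomposition[OF assms]])
  then show ?thesis
    by (simp add: sum_distrib_left mult.commute)
qed

text \<open>The bound by \<open>kappa n\<close> makes the set of ratios bounded above, and a
  nonempty \<open>S\<close> provides a nonzero symmetric tensor, so the \<open>Sup\<close> is a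
  genuine least upper bound.\<close>

lemma c_pis_properties:
  assumes S: "finite S" "S \<noteq> {}"
  shows c_pis_le_kappa: "c_pis n S \<le> kappa n"
    and c_pis_nonneg: "0 \<le> c_pis n S"
    and pis_norm_le_c_pis: "\<And>T. T \<in> tspace S n \<Longrightarrow> symmetric_tensor n T \<Longrightarrow>
          pis_norm S n T \<le> c_pis n S * (\<Sum>ys\<in>words S n. \<bar>T ys\<bar>)"
proof -
  let ?C = "{pis_norm S n T / pi_norm S n T | T.
       T \<in> tspace S n \<and> symmetric_tensor n T \<and> T \<noteq> (\<lambda>_. 0)}"
  have pos: "(\<Sum>ys\<in>words S n. \<bar>T ys\<bar>) > 0" if T: "T \<in> tspace S n" "T \<noteq> (\<lambda>_. 0)" for T
  proof -
    obtain ys where "T ys \<noteq> 0" using T(2) unfolding fun_eq_iff by blast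
    moreover from this have "ys \<in> words S n" using tspace_eq_0[OF T(1)] by blast
    ultimately show ?thesis
      using S(1) by (intro sum_pos2[of _ ys]) simp_all
  qed
  have ratio: "0 \<le> r \<and> r \<le> kappa n" if "r \<in> ?C" for r
  proof -
    obtain T where T: "r = pis_norm S n T / pi_norm S n T" "T \<in> tspace S n" "symmetric_tensor n T" "T \<noteq> (\<lambda>_. 0)"
      using \<open>r \<in> ?C\<close> by blast
    have r: "r = pis_norm S n T / (\<Sum>ys\<in>words S n. \<bar>T ys\<bar>)"
      unfolding T(1) pi_norm_eq[OF S(1) T(2)] by (rule refl)
    note le = pis_le_symmetric[OF S(1) T(2,3)]
    show ?thesis
      unfolding r using pis_le_norm[OF le] pis_norm_nonneg[OF le] pos[OF T(2,4)]
      by (simp add: pos_divide_le_eq)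
  qed
  have bdd: "bdd_above ?C"
    by (rule bdd_aboveI[of _ "kappa n"]) (rule conjunct2[OF ratio])
  obtain s where s: "s \<in> S" using S(2) by blast
  \<comment> \<open>The constant tensor witnesses that the set of ratios is nonempty.\<close>
  define U where "U ys = (if ys \<in> words S n then 1 else 0 :: real)" for ys
  have "U \<in> tspace S n" by (auto simp: tspace_def U_def words_def)
  moreover have "symmetric_tensor n U"
    by (auto simp: symmetric_tensor_permute_list U_def words_def set_permute_list)
  moreover have "U (replicate n s) \<noteq> 0" using s by (auto simp: U_def words_def)
  then have "U \<noteq> (\<lambda>_. 0)" unfolding fun_eq_iff by blast
  ultimately have U: "pis_norm S n U / pi_norm S n U \<in> ?C" by blast
  show "c_pis n S \<le> kappa n"
    unfolding c_pis_def
  proof (rule cSup_least)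
    show "?C \<noteq> {}" using U by blast
  qed (rule conjunct2[OF ratio])
  show nn: "0 \<le> c_pis n S"
    unfolding c_pis_def using ratio[OF U] cSup_upper[OF U bdd] by linarith
  show "pis_norm S n T \<le> c_pis n S * (\<Sum>ys\<in>words S n. \<bar>T ys\<bar>)"
    if T: "T \<in> tspace S n" "symmetric_tensor n T" for T
  proof (cases "T = (\<lambda>_. 0)")
    case True
    have "pis_le S n (\<lambda>_. 0) 0" by (rule pis_leI[OF pis_sums_zero order_refl])
    then show ?thesis using True by (simp add: pis_le_norm)
  next
    case False
    then have "pis_norm S n T / pi_norm S n T \<in> ?C" using T by blast
    then have "pis_norm S n T / pi_norm S n T \<le> c_pis n S"
      unfolding c_pis_def using bdd by (rule cSup_upper)
    then show ?thesis
      using pos[OF T(1) False] unfolding pi_norm_eq[OF S(1) T(1)] by (simp only: pos_divide_le_eq)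
  qed
qed

section \<open>Falling factorials and counting of injective words and permutations\<close>

definition ffact :: "nat \<Rightarrow> nat \<Rightarrow> real" where
  "ffact N k = (\<Prod>i<k. real N - real i)"

lemma ffact_pos: "k \<le> N \<Longrightarrow> 0 < ffact N k"
  by (auto simp: ffact_def intro!: prod_pos)

lemma ffact_eq_0: "N < k \<Longrightarrow> ffact N k = 0"
  by (auto simp: ffact_def)

lemma ffact_nonneg: "0 \<le> ffact N k"
  using ffact_pos[of k N] ffact_eq_0[of N k] by (cases "k \<le> N") auto

definition distinct_words :: "'a set \<Rightarrow> nat \<Rightarrow> 'a list set" where
  "distinct_words A n = {ws \<in> words A n. distinct ws}"

text \<open>Induction on the word: a new first letter \<open>y\<close> can be lifted to any element
  of its fibre not yet used, and \<open>count_list ys y\<close> of them have been used.\<close>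

lemma card_distinct_lifts:
  fixes x :: "'a \<Rightarrow> 'b"
  assumes A: "finite A" and S: "finite S" "set ys \<subseteq> S"
  shows "real (card {ws \<in> distinct_words A (length ys). map x ws = ys})
    = (\<Prod>j\<in>S. ffact (card {a \<in> A. x a = j}) (count_list ys j))"
  using S(2)
proof (induction ys)
  case Nil
  have "{ws \<in> distinct_words A (length ([] :: 'b list)). map x ws = []} = {[]}"
    by (auto simp: distinct_words_def words_def)
  then show ?case by (simp add: ffact_def)
next
  case (Cons y ys)
  let ?D = "{ws \<in> distinct_words A (length ys). map x ws = ys}"
  let ?F = "\<lambda>j. {a \<in> A. x a = j}"
  have fin: "finite ?D" using A by (simp add: distinct_words_def)
  have "{ws \<in> distinct_words A (length (y # ys)). map x ws = y # ys}
      = (\<lambda>(ws, a). a # ws) ` (SIGMA ws:?D. ?F y - set ws)"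
    by (auto simp: distinct_words_def words_Suc image_iff)
  moreover have "inj_on (\<lambda>(ws, a). a # ws) (SIGMA ws:?D. ?F y - set ws)"
    by (auto simp: inj_on_def)
  ultimately have "card {ws \<in> distinct_words A (length (y # ys)). map x ws = y # ys}
      = card (SIGMA ws:?D. ?F y - set ws)"
    by (simp only: card_image)
  also have "\<dots> = (\<Sum>ws\<in>?D. card (?F y - set ws))"
    using A fin by (intro card_SigmaI) auto
  finally have "real (card {ws \<in> distinct_words A (length (y # ys)). map x ws = y # ys})
      = (\<Sum>ws\<in>?D. real (card (?F y - set ws)))" by simp
  also have "\<dots> = (\<Sum>ws\<in>?D. real (card (?F y)) - real (count_list ys y))"
  proof (rule sum.cong[OF refl])
    fix ws assume ws: "ws \<in> ?D"
    then have dist: "distinct ws" and sub: "set ws \<subseteq> A" and xs: "map x ws = ys"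
      by (auto simp: distinct_words_def words_def)
    have eq: "?F y \<inter> set ws = set (filter (\<lambda>a. x a = y) ws)" using sub by auto
    have cnt: "card (?F y \<inter> set ws) = count_list ys y"
      unfolding eq distinct_card[OF distinct_filter[OF dist]] xs[symmetric] by (induction ws) auto
    have "card (?F y - set ws) = card (?F y) - card (?F y \<inter> set ws)"
      using A by (simp add: card_Diff_subset_Int)
    moreover have "card (?F y \<inter> set ws) \<le> card (?F y)"
      using A by (intro card_mono) auto
    ultimately show "real (card (?F y - set ws)) = real (card (?F y)) - real (count_list ys y)"
      by (simp add: cnt of_nat_diff)
  qed
  also have "\<dots> = (\<Prod>j\<in>S. ffact (card (?F j)) (count_list ys j)) * (real (card (?F y)) - real (count_list ys y))"
    using Cons by simp
  also have "\<dots> = (\<Prod>j\<in>S. ffact (card (?F j)) (count_list (y # ys) j))"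
  proof -
    have y: "y \<in> S" using Cons.prems by simp
    have "(\<Prod>j\<in>S - {y}. ffact (card (?F j)) (count_list (y # ys) j))
        = (\<Prod>j\<in>S - {y}. ffact (card (?F j)) (count_list ys j))"
      by (rule prod.cong) auto
    moreover have "ffact (card (?F y)) (count_list (y # ys) y)
        = ffact (card (?F y)) (count_list ys y) * (real (card (?F y)) - real (count_list ys y))"
      by (simp add: ffact_def flip: Suc_eq_plus1)
    ultimately show ?thesis
      by (simp only: prod.remove[OF S(1) y] ac_simps)
  qed
  finally show ?case .
qed

text \<open>The previous count for the map onto a one-letter alphabet.\<close>

lemma card_distinct_words:
  assumes "finite A"
  shows "real (card (distinct_words A n)) = ffact (card A) n"
proof -
  have "{ws \<in> distinct_words A (length (replicate n ())). map (\<lambda>_. ()) ws = replicate n ()} = distinct_words A n"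
    by (auto simp: distinct_words_def words_def map_replicate_const)
  moreover have "count_list (replicate n ()) () = n" by (induction n) auto
  ultimately show ?thesis
    using card_distinct_lifts[of A "{()}" "replicate n ()" "\<lambda>_. ()"] assms by (simp add: subset_iff)
qed

text \<open>The symmetric group acts transitively on injective words: the map \<open>ws\<close> to
  \<open>vs\<close> is extended by any bijection between the complements, which have equal
  size.\<close>

lemma permutes_map_distinct:
  assumes A: "finite A" and "ws \<in> distinct_words A n" "vs \<in> distinct_words A n"
  obtains \<pi> where "\<pi> permutes A" "map \<pi> ws = vs"
proof -
  have ws: "length ws = n" "set ws \<subseteq> A" "distinct ws" and vs: "length vs = n" "set vs \<subseteq> A" "distinct vs"
    using assms by (auto simp: distinct_words_def words_def)
  have cards: "card (set ws) = n" "card (set vs) = n"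
    using ws vs by (simp_all add: distinct_card)
  then have "card (A - set ws) = card (A - set vs)"
    using ws vs by (simp add: card_Diff_subset)
  then obtain g where g: "bij_betw g (A - set ws) (A - set vs)"
    using A by (meson finite_Diff finite_same_card_bij)
  define f where "f = the \<circ> map_of (zip ws vs)"
  have f: "f (ws ! i) = vs ! i" if "i < n" for i
    using that ws vs by (simp add: f_def map_of_zip_nth)
  have map: "map f ws = vs"
    using ws vs f by (intro nth_equalityI) auto
  have "bij_betw f (set ws) (set vs)"
    unfolding bij_betw_def
  proof
    show im: "f ` set ws = set vs" by (simp flip: map set_map)
    show "inj_on f (set ws)" by (rule eq_card_imp_inj_on) (simp_all add: im cards)
  qed
  then have "bij_betw (\<lambda>a. if a \<in> set ws then f a else g a) (set ws \<union> (A - set ws)) (set vs \<union> (A - set vs))"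
    using g by (rule bij_betw_disjoint_Un) auto
  then have b: "bij_betw (\<lambda>a. if a \<in> set ws then f a else g a) A A"
    using ws vs by (simp add: Un_absorb1)
  define \<pi> where "\<pi> a = (if a \<in> A then if a \<in> set ws then f a else g a else a)" for a
  have "bij_betw \<pi> A A"
    using b by (rule bij_betw_cong[THEN iffD1, rotated]) (simp add: \<pi>_def)
  then have "\<pi> permutes A" by (rule bij_imp_permutes) (simp add: \<pi>_def)
  moreover have "map \<pi> ws = map f ws" using ws by (auto simp: \<pi>_def)
  ultimately show thesis using map by (intro that) auto
qed

lemma map_permutes_distinct_words:
  assumes "\<sigma> permutes A" "us \<in> distinct_words A n"
  shows "map \<sigma> us \<in> distinct_words A n"
proof -
  have "\<sigma> ` set us \<subseteq> \<sigma> ` A"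
    using assms(2) by (auto simp: distinct_words_def words_def)
  then show ?thesis
    using assms(2) permutes_inj_on[OF assms(1)]
    by (simp add: distinct_words_def words_def distinct_map permutes_image[OF assms(1)])
qed

text \<open>By transitivity each injective word is the image of \<open>us\<close> under equally many
  permutations, so the image of a uniform permutation is uniform on injective words.\<close>

lemma card_permutes_prefix:
  assumes A: "finite A" and us: "us \<in> distinct_words A n" and ws: "ws \<in> distinct_words A n"
  shows "real (card {\<sigma>. \<sigma> permutes A \<and> map \<sigma> us = ws}) / fact (card A) = 1 / ffact (card A) n"
proof -
  let ?C = "\<lambda>ws. {\<sigma>. \<sigma> permutes A \<and> map \<sigma> us = ws}"
  let ?P = "{\<sigma>. \<sigma> permutes A}"
  have finP: "finite ?P" using A by (rule finite_permutations)
  \<comment> \<open>One inequality for arbitrary \<open>u\<close> and \<open>v\<close> suffices;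
    exchanging them gives equality.\<close>
  have le: "card (?C u) \<le> card (?C v)" if uv: "u \<in> distinct_words A n" "v \<in> distinct_words A n" for u v
  proof -
    obtain \<pi> where \<pi>: "\<pi> permutes A" "map \<pi> u = v" using permutes_map_distinct[OF A uv] .
    have "inj_on ((\<circ>) \<pi>) (?C u)"
      using permutes_inj[OF \<pi>(1)] by (auto intro!: inj_onI simp: fun_eq_iff inj_eq)
    moreover have "(\<circ>) \<pi> ` ?C u \<subseteq> ?C v"
      using \<pi> by (auto intro: permutes_compose)
    ultimately show ?thesis
      by (rule card_inj_on_le) (rule finite_subset[OF _ finP], auto)
  qed
  have img: "(\<lambda>\<sigma>. map \<sigma> us) ` ?P \<subseteq> distinct_words A n"
    using map_permutes_distinct_words[OF _ us] by blast
  have "(\<Sum>v\<in>distinct_words A n. sum (\<lambda>_. 1 :: real) {\<sigma> \<in> ?P. map \<sigma> us = v}) = sum (\<lambda>_. 1) ?P"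
    using finP A by (intro sum.group img) (auto simp: distinct_words_def)
  then have "fact (card A) = (\<Sum>v\<in>distinct_words A n. real (card (?C v)))"
    by (simp add: card_permutations[OF refl A])
  also have "\<dots> = (\<Sum>v\<in>distinct_words A n. real (card (?C ws)))"
    by (intro sum.cong refl arg_cong[where f = real] antisym le ws)
  also have "\<dots> = ffact (card A) n * real (card (?C ws))"
    by (simp add: card_distinct_words[OF A])
  finally have *: "fact (card A) = ffact (card A) n * real (card (?C ws))" .
  then have "ffact (card A) n * real (card (?C ws)) \<noteq> 0" by (metis fact_nonzero)
  then show ?thesis unfolding * by (simp add: field_simps)
qed

section \<open>The law of a sample drawn without replacement\<close>

lemma upt_distinct_words: "n \<le> N \<Longrightarrow> [1..<n+1] \<in> distinct_words {1..N} n"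
  by (auto simp: distinct_words_def words_def)

text \<open>Change of variables: an expectation under \<open>mu\<close> is an average over uniformly
  random permutations.\<close>

lemma sum_mu:
  assumes S: "finite S" "x ` {1..N} \<subseteq> S" and n: "n \<le> N"
  shows "(\<Sum>ys\<in>words S n. mu n N x ys * g ys)
    = (\<Sum>\<sigma>\<in>{\<sigma>. \<sigma> permutes {1..N}}. g (map (x \<circ> \<sigma>) [1..<n+1])) / fact N"
proof -
  let ?P = "{\<sigma>. \<sigma> permutes {1..N}}" and ?m = "\<lambda>\<sigma>. map (x \<circ> \<sigma>) [1..<n+1]"
  have img: "?m ` ?P \<subseteq> words S n"
  proof (clarify)
    fix \<sigma> assume \<sigma>: "\<sigma> permutes {1..N}"
    have "x (\<sigma> i) \<in> S" if "i \<in> {1..n}" for i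
    proof -
      have "\<sigma> i \<in> {1..N}" using that n by (subst permutes_in_image[OF \<sigma>]) auto
      then show ?thesis using S by blast
    qed
    then show "?m \<sigma> \<in> words S n" by (auto simp: words_def)
  qed
  have "(\<Sum>\<sigma>\<in>?P. g (?m \<sigma>)) = (\<Sum>ys\<in>words S n. sum (\<lambda>\<sigma>. g (?m \<sigma>)) {\<sigma> \<in> ?P. ?m \<sigma> = ys})"
    using S by (intro sum.group[symmetric] img) (auto intro: finite_permutations)
  also have "\<dots> = (\<Sum>ys\<in>words S n. real (card {\<sigma> \<in> ?P. ?m \<sigma> = ys}) * g ys)"
    by (intro sum.cong refl) simp
  finally show ?thesis
    by (simp add: mu_def sum_divide_distrib)
qed

text \<open>Used twice: the point probabilities of \<open>mu\<close> follow from those of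
  \<open>chi\<close>, and contractivity under push-forward bounds the norm of \<open>mu\<close> by
  that of \<open>chi\<close>.\<close>

lemma mu_eq_push:
  assumes n: "n \<le> N"
  shows "mu n N x = push x {1..N} n (chi n N)"
proof
  fix zs
  have chi: "chi n N = mu n N id" by (simp add: chi_def mu_def)
  have "push x {1..N} n (chi n N) zs = (\<Sum>ys\<in>words {1..N} n. mu n N id ys * (if map x ys = zs then 1 else 0))"
    unfolding push_def chi by (subst sum.inter_filter) (auto intro!: sum.cong)
  also have "\<dots> = (\<Sum>\<sigma>\<in>{\<sigma>. \<sigma> permutes {1..N}}. if map x (map (id \<circ> \<sigma>) [1..<n+1]) = zs then 1 else 0) / fact N"
    by (rule sum_mu) (use n in auto)
  also have "\<dots> = real (card {\<sigma> \<in> {\<sigma>. \<sigma> permutes {1..N}}. map (x \<circ> \<sigma>) [1..<n+1] = zs}) / fact N"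
    by (subst sum.inter_filter[symmetric, OF finite_permutations]) (simp_all add: comp_assoc)
  also have "\<dots> = mu n N x zs"
    by (simp only: mu_def mem_Collect_eq)
  finally show "mu n N x zs = push x {1..N} n (chi n N) zs" by (rule sym)
qed

lemma mu_eq_0:
  assumes "x ` {1..N} \<subseteq> S" "n \<le> N" "ys \<notin> words S n"
  shows "mu n N x ys = 0"
proof -
  have "{ws \<in> words {1..N} n. map x ws = ys} = {}"
    using assms by (fastforce simp: words_def)
  then show ?thesis by (simp only: mu_eq_push[OF assms(2)] push_def sum.empty)
qed

lemma mu_in_tspace: "x ` {1..N} \<subseteq> S \<Longrightarrow> n \<le> N \<Longrightarrow> mu n N x \<in> tspace S n"
  using mu_eq_0[of x N S n] by (fastforce simp: tspace_def words_def)

lemma chi_eq: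
  assumes n: "n \<le> N"
  shows "chi n N ys = (if ys \<in> distinct_words {1..N} n then 1 / ffact N n else 0)"
proof (cases "ys \<in> distinct_words {1..N} n")
  case True
  then show ?thesis
    using card_permutes_prefix[OF _ upt_distinct_words[OF n] True] by (simp add: chi_def)
next
  case False
  have *: "{\<sigma>. \<sigma> permutes {1..N} \<and> map \<sigma> [1..<n+1] = ys} = {}"
    using False map_permutes_distinct_words[OF _ upt_distinct_words[OF n]] by blast
  have "chi n N ys = 0" unfolding chi_def * by simp
  then show ?thesis using False by simp
qed

text \<open>The multivariate hypergeometric law: \<open>chi\<close> is uniform on injective words,
  so it remains to count the injective lifts of \<open>ys\<close>.\<close>

lemma mu_eq:
  assumes S: "finite S" and n: "n \<le> N" and ys: "ys \<in> words S n"
  shows "mu n N x ys = (\<Prod>j\<in>S. ffact (card {i \<in> {1..N}. x i = j}) (count_list ys j)) / ffact N n"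
proof -
  have len: "length ys = n" "set ys \<subseteq> S" using ys by (auto simp: words_def)
  have "mu n N x ys = (\<Sum>ws\<in>{ws \<in> words {1..N} n. map x ws = ys}. if distinct ws then 1 / ffact N n else 0)"
    unfolding mu_eq_push[OF n] push_def chi_eq[OF n]
    by (rule sum.cong) (auto simp: distinct_words_def)
  also have "\<dots> = (\<Sum>ws\<in>{ws \<in> distinct_words {1..N} n. map x ws = ys}. 1 / ffact N n)"
    by (rule sum.mono_neutral_cong_right) (auto simp: distinct_words_def)
  also have "\<dots> = real (card {ws \<in> distinct_words {1..N} (length ys). map x ws = ys}) / ffact N n"
    by (simp add: len)
  finally show ?thesis
    using card_distinct_lifts[OF _ S len(2), of "{1..N}" x] by simp
qed

lemma count_list_permute_list:
  "\<sigma> permutes {..<length ys} \<Longrightarrow> count_list (permute_list \<sigma> ys) j = count_list ys j"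
  by (simp flip: count_mset)

lemma symmetric_tensor_mu:
  assumes "finite S" "x ` {1..N} \<subseteq> S" "n \<le> N"
  shows "symmetric_tensor n (mu n N x)"
  unfolding symmetric_tensor_permute_list
proof (intro allI impI)
  fix ys :: "'a list" and \<sigma> assume \<sigma>: "\<sigma> permutes {..<n}" "length ys = n"
  have w: "permute_list \<sigma> ys \<in> words S n \<longleftrightarrow> ys \<in> words S n"
    using \<sigma> by (simp add: words_def)
  show "mu n N x (permute_list \<sigma> ys) = mu n N x ys"
  proof (cases "ys \<in> words S n")
    case True
    then show ?thesis using \<sigma> w assms by (simp add: mu_eq count_list_permute_list)
  next
    case False
    then show ?thesis using w mu_eq_0[OF assms(2,3)] by simp
  qed
qed

lemma symmetric_tensor_tpow: "symmetric_tensor n (tpow S n x)"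
proof -
  have "prod_list (map x ys) = prod_mset (image_mset x (mset ys))" for ys
    by (simp add: prod_mset_prod_list flip: mset_map)
  then show ?thesis
    by (simp add: symmetric_tensor_permute_list tpow_eq words_def)
qed

lemma symmetric_tensor_diff:
  "symmetric_tensor n T \<Longrightarrow> symmetric_tensor n U \<Longrightarrow> symmetric_tensor n (\<lambda>ys. T ys - U ys)"
  by (simp add: symmetric_tensor_def)

lemma tpow_in_tspace: "tpow S n x \<in> tspace S n"
  by (auto simp: tspace_def tpow_eq words_def split: if_splits)

lemma tspace_diff: "T \<in> tspace S n \<Longrightarrow> U \<in> tspace S n \<Longrightarrow> (\<lambda>ys. T ys - U ys) \<in> tspace S n"
  by (simp add: tspace_def) metis

lemma sum_mu_eq_1:
  assumes "finite S" "x ` {1..N} \<subseteq> S" "n \<le> N"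
  shows "(\<Sum>ys\<in>words S n. mu n N x ys) = 1"
  using sum_mu[OF assms, of "\<lambda>_. 1"] by (simp add: card_permutations[OF refl])

text \<open>Linearity of expectation: each of the \<open>n\<close> draws is uniform on
  \<open>{1..N}\<close> and so has colour \<open>j\<close> with probability equal to its
  proportion.\<close>

lemma sum_mu_count:
  assumes S: "finite S" "x ` {1..N} \<subseteq> S" and n: "n \<le> N" "0 < N"
  shows "(\<Sum>ys\<in>words S n. mu n N x ys * real (count_list ys j))
      = real n * real (card {i \<in> {1..N}. x i = j}) / real N"
proof -
  let ?P = "{\<sigma>. \<sigma> permutes {1..N}}" and ?F = "{i \<in> {1..N}. x i = j}"
  have finP: "finite ?P" by (rule finite_permutations) simp
  \<comment> \<open>The case of prefixes of length one in
    \<open>card_permutes_prefix\<close>.\<close>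
  have single: "real (card {\<sigma>. \<sigma> permutes {1..N} \<and> \<sigma> i = k}) / fact N = 1 / real N"
    if "i \<in> {1..N}" "k \<in> {1..N}" for i k
    using card_permutes_prefix[of "{1..N}" "[i]" 1 "[k]"] that
    by (simp add: distinct_words_def words_def ffact_def)
  have cnt: "real (count_list (map f us) j) = (\<Sum>i\<leftarrow>us. if f i = j then 1 else 0)" for f :: "nat \<Rightarrow> 'a" and us
    by (induction us) auto
  have "(\<Sum>ys\<in>words S n. mu n N x ys * real (count_list ys j))
      = (\<Sum>\<sigma>\<in>?P. \<Sum>i\<in>{1..n}. if x (\<sigma> i) = j then 1 else 0) / fact N"
    unfolding sum_mu[OF S n(1)] cnt
    by (simp only: sum_list_distinct_conv_sum_set[OF distinct_upt] set_upt o_def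
        atLeastLessThanSuc_atLeastAtMost Suc_eq_plus1[symmetric])
  also have "\<dots> = (\<Sum>i\<in>{1..n}. \<Sum>\<sigma>\<in>?P. if x (\<sigma> i) = j then 1 else 0) / fact N"
    by (subst sum.swap) (rule refl)
  also have "\<dots> = (\<Sum>i\<in>{1..n}. real (card ?F) / real N)"
    unfolding sum_divide_distrib[of _ "{1..n}"]
  proof (rule sum.cong[OF refl])
    fix i assume "i \<in> {1..n}"
    then have i: "i \<in> {1..N}" using n by simp
    have "(\<Sum>\<sigma>\<in>?P. if x (\<sigma> i) = j then 1 else 0 :: real)
        = (\<Sum>k\<in>{1..N}. \<Sum>\<sigma>\<in>{\<sigma> \<in> ?P. \<sigma> i = k}. if x (\<sigma> i) = j then 1 else 0)"
      by (rule sum.group[symmetric]) (use finP i permutes_in_image in fastforce)+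
    also have "\<dots> = (\<Sum>k\<in>{1..N}. if x k = j then real (card {\<sigma>. \<sigma> permutes {1..N} \<and> \<sigma> i = k}) else 0)"
      by (rule sum.cong) auto
    also have "\<dots> = (\<Sum>k\<in>?F. real (card {\<sigma>. \<sigma> permutes {1..N} \<and> \<sigma> i = k}))"
      by (subst sum.inter_filter) auto
    finally have "(\<Sum>\<sigma>\<in>?P. if x (\<sigma> i) = j then 1 else 0 :: real) / fact N
        = (\<Sum>k\<in>?F. real (card {\<sigma>. \<sigma> permutes {1..N} \<and> \<sigma> i = k}) / fact N)"
      by (simp only: sum_divide_distrib)
    also have "\<dots> = (\<Sum>k\<in>?F. 1 / real N)"
      by (intro sum.cong refl single i) auto
    finally show "(\<Sum>\<sigma>\<in>?P. if x (\<sigma> i) = j then 1 else 0 :: real) / fact N = real (card ?F) / real N"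
      by simp
  qed
  finally show ?thesis by simp
qed

text \<open>For positive \<open>k\<close>, the falling factorial divided by \<open>k ^ c\<close>;
  for \<open>c \<le> k\<close> it is the probability that \<open>c\<close> independent uniform draws
  from \<open>k\<close> points are distinct. For \<open>k = 0\<close> all factors are
  \<open>1\<close>.\<close>

definition fratio :: "nat \<Rightarrow> nat \<Rightarrow> real" where
  "fratio k c = (\<Prod>i<c. 1 - real i / real k)"

lemma ffact_eq_fratio: "0 < k \<or> c = 0 \<Longrightarrow> ffact k c = real k ^ c * fratio k c"
proof -
  assume "0 < k \<or> c = 0"
  then have "ffact k c = (\<Prod>i<c. real k * (1 - real i / real k))"
    unfolding ffact_def by (intro prod.cong) (auto simp: field_simps)
  then show ?thesis by (simp add: fratio_def prod.distrib)
qed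

lemma fratio_pos: "c \<le> k \<Longrightarrow> 0 < fratio k c"
  by (auto simp: fratio_def intro!: prod_pos)

lemma fratio_Suc: "fratio k (Suc c) = fratio k c * (1 - real c / real k)"
  by (simp add: fratio_def)

lemma fratio_nonneg: "c \<le> Suc k \<Longrightarrow> 0 \<le> fratio k c"
  unfolding fratio_def
proof (intro prod_nonneg)
  fix i assume "c \<le> Suc k" "i \<in> {..<c}"
  then have "real i \<le> real k" by simp
  then show "0 \<le> 1 - real i / real k" by (cases "k = 0") auto
qed

section \<open>Sampling with and without replacement\<close>

text \<open>Induction on the sample size: remove an element of a colour for which the sampled
  proportion is maximal, hence at least the overall one.\<close>

lemma prod_fratio_le:
  assumes S: "finite S" and "\<And>j. j \<in> S \<Longrightarrow> c j \<le> f j"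
  shows "(\<Prod>j\<in>S. fratio (f j) (Suc (c j))) \<le> fratio (sum f S) (sum c S)"
  using assms(2)
proof (induction "sum c S" arbitrary: c)
  case 0
  then have "c j = 0" if "j \<in> S" for j using S that by simp
  then have "(\<Prod>j\<in>S. fratio (f j) (Suc (c j))) = 1" by (simp add: fratio_def)
  then show ?case using 0 by (simp add: fratio_def)
next
  case (Suc n)
  let ?N = "sum f S"
  have nN: "Suc n \<le> ?N"
    unfolding Suc.hyps(2) by (rule sum_mono) (rule Suc.prems)
  \<comment> \<open>Pigeonhole: otherwise summation over \<open>S\<close> gives
    \<open>Suc n * ?N < Suc n * ?N\<close>. Colours with \<open>c j = 0\<close> contribute only weak
    inequalities, so strictness comes from one with \<open>c j\<close> nonzero.\<close>
  have "\<exists>j\<in>S. 0 < c j \<and> Suc n * f j \<le> c j * ?N"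
  proof (rule ccontr)
    assume "\<not> ?thesis"
    then have *: "c j = 0 \<or> c j * ?N < Suc n * f j" if "j \<in> S" for j
      using that by (metis not_gr0 not_less)
    have "\<exists>j\<in>S. c j \<noteq> 0" using Suc.hyps(2) by (metis sum.neutral nat.distinct(1))
    then have "(\<Sum>j\<in>S. c j * ?N) < (\<Sum>j\<in>S. Suc n * f j)"
      using * S by (intro sum_strict_mono_ex1) force+
    then show False
      by (simp only: Suc.hyps(2) sum_distrib_left[symmetric] sum_distrib_right[symmetric])
  qed
  then obtain j where j: "j \<in> S" "0 < c j" "Suc n * f j \<le> c j * ?N" by blast
  define c' where "c' = c(j := c j - 1)"
  have c'j: "Suc (c' j) = c j" using j by (simp add: c'_def)
  have "sum c S = Suc (sum c' S)"
  proof -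
    have "sum c' (S - {j}) = sum c (S - {j})" by (rule sum.cong) (auto simp: c'_def)
    then show ?thesis using c'j by (simp add: sum.remove[OF S j(1)])
  qed
  then have n: "n = sum c' S" using Suc.hyps(2) by simp
  have fj: "c j \<le> f j" using Suc.prems j by simp
  have IH: "(\<Prod>j\<in>S. fratio (f j) (Suc (c' j))) \<le> fratio ?N n"
    unfolding n
  proof (rule Suc.hyps(1)[OF n])
    fix i assume "i \<in> S"
    then show "c' i \<le> f i" using Suc.prems[of i] by (auto simp: c'_def)
  qed
  have "(\<Prod>j\<in>S. fratio (f j) (Suc (c j)))
      = (\<Prod>j\<in>S. fratio (f j) (Suc (c' j))) * (1 - real (c j) / real (f j))"
  proof -
    have "(\<Prod>i\<in>S - {j}. fratio (f i) (Suc (c i))) = (\<Prod>i\<in>S - {j}. fratio (f i) (Suc (c' i)))"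
      by (rule prod.cong) (auto simp: c'_def)
    moreover have "fratio (f j) (Suc (c j)) = fratio (f j) (Suc (c' j)) * (1 - real (c j) / real (f j))"
      by (simp only: fratio_Suc[of _ "c j"] c'j)
    ultimately show ?thesis by (simp only: prod.remove[OF S j(1)] ac_simps)
  qed
  \<comment> \<open>The left side loses the factor \<open>1 - c j / f j\<close>, the right side
    \<open>1 - n / ?N\<close>; the choice of \<open>j\<close> makes the former the smaller
    one.\<close>
  also have "\<dots> \<le> fratio ?N n * (1 - real n / real ?N)"
  proof (rule mult_mono[OF IH])
    have "real n * real (f j) \<le> real (Suc n * f j)" by (simp add: distrib_right)
    also have "\<dots> \<le> real (c j * ?N)" using j(3) by (simp only: of_nat_le_iff)
    finally have "real n / real ?N \<le> real (c j) / real (f j)"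
      using nN fj j(2) by (simp add: field_simps del: of_nat_sum)
    then show "1 - real (c j) / real (f j) \<le> 1 - real n / real ?N" by simp
    show "0 \<le> fratio ?N n" using nN by (simp add: fratio_nonneg del: of_nat_sum)
    show "0 \<le> 1 - real (c j) / real (f j)" using fj j(2) by (simp add: field_simps)
  qed
  also have "\<dots> = fratio ?N (Suc n)" by (rule fratio_Suc[symmetric])
  finally show ?case using Suc.hyps(2) by simp
qed

lemma prod_list_map_count:
  fixes x :: "'a \<Rightarrow> real"
  assumes "finite S" "set ys \<subseteq> S"
  shows "prod_list (map x ys) = (\<Prod>j\<in>S. x j ^ count_list ys j)"
  using assms(2)
proof (induction ys)
  case (Cons y ys)
  then have y: "y \<in> S" by simp
  have "(\<Prod>j\<in>S. x j ^ count_list (y # ys) j) = x y ^ Suc (count_list ys y) * (\<Prod>j\<in>S - {y}. x j ^ count_list (y # ys) j)"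
    by (simp add: prod.remove[OF assms(1) y] flip: Suc_eq_plus1)
  also have "(\<Prod>j\<in>S - {y}. x j ^ count_list (y # ys) j) = (\<Prod>j\<in>S - {y}. x j ^ count_list ys j)"
    by (rule prod.cong) auto
  finally show ?case
    using Cons by (simp add: prod.remove[OF assms(1) y] mult.assoc del: count_list.simps)
qed simp

lemma sum_fibres:
  assumes "finite S" "x ` {1..N} \<subseteq> S"
  shows "(\<Sum>j\<in>S. card {i \<in> {1..N}. x i = j}) = N"
  using sum.group[of "{1..N}" S x "\<lambda>_. 1 :: nat"] assms by simp

text \<open>The colour proportions; the tensor power of this vector is the law of sampling with
  replacement.\<close>

definition empirical :: "nat \<Rightarrow> (nat \<Rightarrow> 'a) \<Rightarrow> 'a \<Rightarrow> real" where
  "empirical N x j = real (card {i \<in> {1..N}. x i = j}) / real N"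

text \<open>The ratio of the two probabilities is bounded below by the product of the
  \<open>1 - c j / f j\<close> through \<open>prod_fratio_le\<close>, and this product by
  \<open>1\<close> minus the sum through the Weierstrass inequality.\<close>

lemma mu_minus_tpow_le:
  assumes S: "finite S" "x ` {1..N} \<subseteq> S" and n: "n \<le> N" "0 < N" and ys: "ys \<in> words S n"
  shows "mu n N x ys - tpow S n (empirical N x) ys
    \<le> mu n N x ys * (\<Sum>j\<in>S. real (count_list ys j) / real (card {i \<in> {1..N}. x i = j}))"
proof -
  define f where "f j = card {i \<in> {1..N}. x i = j}" for j
  define c where "c = count_list ys"
  let ?H = "mu n N x ys" and ?M = "tpow S n (empirical N x) ys"
  have H: "?H = (\<Prod>j\<in>S. ffact (f j) (c j)) / ffact N n"
    using mu_eq[OF S(1) n(1) ys, of x] by (simp add: f_def c_def)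
  have len: "length ys = n" "set ys \<subseteq> S" using ys by (auto simp: words_def)
  have sc: "sum c S = n" using sum_count_set[OF len(2) S(1)] len by (simp add: c_def)
  have sf: "sum f S = N" using sum_fibres[OF S] by (simp add: f_def)
  have M: "?M = (\<Prod>j\<in>S. real (f j) ^ c j) / real N ^ n"
  proof -
    have "?M = (\<Prod>j\<in>S. real (f j) ^ c j / real N ^ c j)"
      using ys prod_list_map_count[OF S(1) len(2)]
      by (simp add: tpow_eq empirical_def f_def c_def power_divide)
    also have "\<dots> = (\<Prod>j\<in>S. real (f j) ^ c j) / real N ^ sum c S"
      by (simp add: prod_dividef power_sum)
    finally show ?thesis by (simp add: sc)
  qed
  show ?thesis
  proof (cases "?H = 0")
    case True
    have "0 \<le> ?M" unfolding M by (intro divide_nonneg_nonneg prod_nonneg) auto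
    then show ?thesis using True by simp
  next
    case False
    \<comment> \<open>A word of positive probability uses no colour more often than it
      occurs.\<close>
    have cf: "c j \<le> f j" if "j \<in> S" for j
    proof (rule ccontr)
      assume "\<not> c j \<le> f j"
      then have "(\<Prod>j\<in>S. ffact (f j) (c j)) = 0"
        using that S(1) by (intro prod_zero bexI[of _ j]) (auto simp: ffact_eq_0)
      then show False using False H by simp
    qed
    \<comment> \<open>The extra factor prolongs each \<open>fratio\<close> from \<open>c j\<close>
      to \<open>Suc (c j)\<close>, the form treated by \<open>prod_fratio_le\<close>.\<close>
    have "?H * (\<Prod>j\<in>S. 1 - real (c j) / real (f j))
        = (\<Prod>j\<in>S. ffact (f j) (c j) * (1 - real (c j) / real (f j))) / ffact N n"
      unfolding H by (simp add: prod.distrib)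
    also have "\<dots> = (\<Prod>j\<in>S. real (f j) ^ c j * fratio (f j) (Suc (c j))) / ffact N n"
    proof -
      have "ffact (f j) (c j) * (1 - real (c j) / real (f j)) = real (f j) ^ c j * fratio (f j) (Suc (c j))"
        if "j \<in> S" for j
        using cf[OF that] by (subst ffact_eq_fratio) (auto simp: fratio_Suc)
      then show ?thesis by simp
    qed
    also have "\<dots> \<le> (\<Prod>j\<in>S. real (f j) ^ c j) * fratio N n / ffact N n"
    proof -
      have "(\<Prod>j\<in>S. fratio (f j) (Suc (c j))) \<le> fratio N n"
        using prod_fratio_le[OF S(1), of c f] cf by (simp add: sf sc)
      then show ?thesis
        unfolding prod.distrib
        by (intro divide_right_mono mult_left_mono ffact_nonneg prod_nonneg) auto
    qed
    also have "\<dots> = ?M"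
      using fratio_pos[OF n(1)] n(2) by (simp add: M ffact_eq_fratio)
    finally have le: "?H * (\<Prod>j\<in>S. 1 - real (c j) / real (f j)) \<le> ?M" .
    have W: "1 - (\<Sum>j\<in>S. real (c j) / real (f j)) \<le> (\<Prod>j\<in>S. 1 - real (c j) / real (f j))"
    proof (rule Weierstrass_prod_ineq)
      fix j assume "j \<in> S"
      then show "real (c j) / real (f j) \<in> {0..1}"
        using cf[of j] by (cases "f j = 0") auto
    qed
    have "0 \<le> ?H" by (simp add: mu_def)
    then have "?H * (1 - (\<Sum>j\<in>S. real (c j) / real (f j))) \<le> ?M"
      using mult_left_mono[OF W] le by (meson order_trans)
    then show ?thesis by (simp add: right_diff_distrib f_def c_def)
  qed
qed

lemma l1norm_empirical:
  assumes "finite S" "x ` {1..N} \<subseteq> S" "0 < N"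
  shows "l1norm S (empirical N x) = 1"
proof -
  have "l1norm S (empirical N x) = real (\<Sum>j\<in>S. card {i \<in> {1..N}. x i = j}) / real N"
    by (simp add: l1norm_def empirical_def sum_divide_distrib)
  then show ?thesis using assms by (simp only: sum_fibres) simp
qed

lemma empirical_l1: "x ` {1..N} \<subseteq> S \<Longrightarrow> empirical N x \<in> l1 S"
proof -
  assume x: "x ` {1..N} \<subseteq> S"
  have "empirical N x s = 0" if "s \<notin> S" for s
  proof -
    have "{i \<in> {1..N}. x i = s} = {}" using x that by blast
    then show ?thesis by (simp only: empirical_def) simp
  qed
  then show ?thesis unfolding l1_def by blast
qed

lemma empirical_nonneg: "0 \<le> empirical N x s"
  by (simp add: empirical_def)

text \<open>Both laws have mass one, so their distance is twice the sum of the positive parts of the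
  difference; the one-sided pointwise bound and the mean colour counts suffice.\<close>

lemma sum_abs_mu_minus_tpow:
  assumes S: "finite S" "x ` {1..N} \<subseteq> S" and n: "n \<le> N" "0 < N"
  shows "(\<Sum>ys\<in>words S n. \<bar>mu n N x ys - tpow S n (empirical N x) ys\<bar>) \<le> 2 * real (card S) * real n / real N"
proof -
  define f where "f j = card {i \<in> {1..N}. x i = j}" for j
  let ?H = "mu n N x" and ?M = "tpow S n (empirical N x)"
  have sumM: "(\<Sum>ys\<in>words S n. ?M ys) = 1"
  proof -
    have "(\<Sum>ys\<in>words S n. ?M ys) = (\<Sum>ys\<in>words S n. \<Prod>i<n. empirical N x (ys ! i))"
      by (rule sum.cong) (auto simp: tpow_def tprod_def words_def)
    also have "\<dots> = l1norm S (empirical N x) ^ n"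
      by (simp add: sum_words_prod[of "\<lambda>_. empirical N x"] l1norm_def empirical_nonneg)
    finally show ?thesis by (simp add: l1norm_empirical[OF S n(2)])
  qed
  have H0: "0 \<le> ?H ys" for ys by (simp add: mu_def)
  have "(\<Sum>ys\<in>words S n. \<bar>?H ys - ?M ys\<bar>)
      \<le> (\<Sum>ys\<in>words S n. 2 * (?H ys * (\<Sum>j\<in>S. real (count_list ys j) / real (f j))) - (?H ys - ?M ys))"
  proof (rule sum_mono)
    fix ys assume "ys \<in> words S n"
    moreover have "0 \<le> ?H ys * (\<Sum>j\<in>S. real (count_list ys j) / real (f j))"
      by (intro mult_nonneg_nonneg H0 sum_nonneg) auto
    ultimately show "\<bar>?H ys - ?M ys\<bar> \<le> 2 * (?H ys * (\<Sum>j\<in>S. real (count_list ys j) / real (f j))) - (?H ys - ?M ys)"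
      using mu_minus_tpow_le[OF S n, of ys] unfolding f_def[symmetric] by linarith
  qed
  also have "\<dots> = 2 * (\<Sum>ys\<in>words S n. ?H ys * (\<Sum>j\<in>S. real (count_list ys j) / real (f j)))"
    unfolding sum_subtractf sum_mu_eq_1[OF S n(1)] sumM by (simp add: sum_distrib_left)
  also have "(\<Sum>ys\<in>words S n. ?H ys * (\<Sum>j\<in>S. real (count_list ys j) / real (f j)))
      = (\<Sum>j\<in>S. (\<Sum>ys\<in>words S n. ?H ys * real (count_list ys j)) / real (f j))"
    unfolding sum_distrib_left sum_divide_distrib times_divide_eq_right by (rule sum.swap)
  also have "\<dots> = (\<Sum>j\<in>S. real n * real (f j) / real N / real (f j))"
    by (simp add: sum_mu_count[OF S n] f_def)
  \<comment> \<open>A colour that does not occur has \<open>f j = 0\<close> and contributes zero,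
    hence an inequality.\<close>
  also have "\<dots> \<le> (\<Sum>j\<in>S. real n / real N)"
    by (intro sum_mono) simp
  finally show ?thesis by (simp add: mult_ac)
qed

text \<open>Split \<open>mu\<close> into the law with replacement, a single tensor power of cost
  one, and a symmetric error whose cost is at most \<open>c_pis\<close> times its \<open>l1\<close>
  norm.\<close>

lemma pis_norm_mu_le:
  assumes S: "finite S" "x ` {1..N} \<subseteq> S" and n: "n \<le> N" "0 < N"
  shows "pis_norm S n (mu n N x) \<le> 1 + c_pis n S * (2 * real (card S) * real n / real N)"
proof -
  let ?H = "mu n N x" and ?M = "tpow S n (empirical N x)"
  have "S \<noteq> {}" using S n by auto
  define D where "D ys = ?H ys - ?M ys" for ys
  have D: "D \<in> tspace S n" "symmetric_tensor n D"
    unfolding D_def using S n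
    by (auto intro!: tspace_diff symmetric_tensor_diff mu_in_tspace tpow_in_tspace symmetric_tensor_mu symmetric_tensor_tpow)
  have "pis_norm S n D \<le> c_pis n S * (\<Sum>ys\<in>words S n. \<bar>D ys\<bar>)"
    by (rule pis_norm_le_c_pis[OF S(1) \<open>S \<noteq> {}\<close> D])
  also have "\<dots> \<le> c_pis n S * (2 * real (card S) * real n / real N)"
    unfolding D_def
    by (intro mult_left_mono sum_abs_mu_minus_tpow[OF S n] c_pis_nonneg[OF S(1) \<open>S \<noteq> {}\<close>])
  finally have le: "pis_norm S n D \<le> c_pis n S * (2 * real (card S) * real n / real N)" .
  have "pis_le S n ?M 1"
    by (rule pis_leI[OF pis_sums_tpow])
       (simp_all add: empirical_l1[OF S(2)] empirical_nonneg l1norm_empirical[OF S n(2)])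
  then have "pis_le S n (\<lambda>ys. ?M ys + D ys) (1 + pis_norm S n D)"
    by (rule pis_le_add) (rule pis_le_self[OF pis_le_symmetric[OF S(1) D]])
  then show ?thesis using le pis_le_norm by (fastforce simp: D_def)
qed

section \<open>The lower bound\<close>

text \<open>Duality: evaluation at \<open>ys\<close> is a linear functional, and \<open>b\<close>
  bounds it on powers of nonnegative unit vectors.\<close>

lemma pis_norm_point_lower:
  assumes ne: "pis_sums S n T \<noteq> {}"
    and b: "0 < b" "\<And>x. x \<in> l1 S \<Longrightarrow> (\<And>s. 0 \<le> x s) \<Longrightarrow> tpow S n x ys \<le> b * l1norm S x ^ n"
  shows "T ys / b \<le> pis_norm S n T"
  unfolding pis_norm_eq_Inf
proof (rule cInf_greatest[OF ne])
  fix v assume "v \<in> pis_sums S n T"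
  then obtain K :: nat and a x where v: "v = (\<Sum>k<K. \<bar>a k\<bar> * l1norm S (x k) ^ n)"
    "\<forall>k<K. x k \<in> l1 S \<and> (\<forall>s. x k s \<ge> 0)" "T = (\<lambda>ys. \<Sum>k<K. a k * tpow S n (x k) ys)"
    by (rule pis_sumsE) blast
  have "T ys \<le> (\<Sum>k<K. \<bar>a k\<bar> * (b * l1norm S (x k) ^ n))"
    unfolding v(3)
  proof (rule sum_mono)
    fix k assume k: "k \<in> {..<K}"
    have x: "x k \<in> l1 S" "\<And>s. 0 \<le> x k s" using v(2) k by auto
    have "0 \<le> tpow S n (x k) ys"
      using x by (auto simp: tpow_eq intro!: prod_list_nonneg)
    then have "a k * tpow S n (x k) ys \<le> \<bar>a k\<bar> * tpow S n (x k) ys"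
      by (intro mult_right_mono) auto
    also have "\<dots> \<le> \<bar>a k\<bar> * (b * l1norm S (x k) ^ n)"
      by (intro mult_left_mono b x) auto
    finally show "a k * tpow S n (x k) ys \<le> \<bar>a k\<bar> * (b * l1norm S (x k) ^ n)" .
  qed
  also have "\<dots> = b * v" by (simp add: v(1) sum_distrib_left mult_ac)
  finally show "T ys / b \<le> v" using b(1) by (simp add: pos_divide_le_eq mult.commute)
qed

text \<open>Weighted AM-GM, from \<open>t \<le> exp (t - 1)\<close>.\<close>

lemma tpow_le:
  assumes S: "finite S" and ys: "ys \<in> words S n" and n: "0 < n"
    and c: "\<And>j. j \<in> S \<Longrightarrow> 0 < count_list ys j" and x: "\<And>s. 0 \<le> x s"
  shows "tpow S n x ys \<le> (\<Prod>j\<in>S. (real (count_list ys j) / real n) ^ count_list ys j) * l1norm S x ^ n"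
proof -
  define c where "c = count_list ys"
  define s where "s = l1norm S x"
  have s_sum: "s = (\<Sum>j\<in>S. x j)" using x by (simp add: s_def l1norm_def)
  have len: "length ys = n" "set ys \<subseteq> S" using ys by (auto simp: words_def)
  have sc: "sum c S = n" using sum_count_set[OF len(2) S] len by (simp add: c_def)
  have tp: "tpow S n x ys = (\<Prod>j\<in>S. x j ^ c j)"
    using ys prod_list_map_count[OF S len(2)] by (simp add: tpow_eq c_def)
  have c0: "0 < c j" if "j \<in> S" for j using c that by (simp add: c_def)
  show ?thesis
  proof (cases "s = 0")
    case True
    then have z: "\<forall>j\<in>S. x j = 0" using S x by (simp add: s_sum sum_nonneg_eq_0_iff)
    have "S \<noteq> {}" using sc n by auto
    then have "tpow S n x ys = 0"
      unfolding tp using z c0 S by (intro prod_zero) (auto simp: zero_power)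
    then show ?thesis by (simp add: prod_nonneg)
  next
    case False
    then have s: "0 < s" using l1norm_nonneg[of S x] unfolding s_def by linarith
    \<comment> \<open>The coordinate \<open>x j\<close> relative to its value
      \<open>s * c j / n\<close> at the maximizer; with this scaling the exponents
      \<open>c j * (t j - 1)\<close> sum to zero.\<close>
    define t where "t j = real n * x j / (real (c j) * s)" for j
    have "tpow S n x ys = (\<Prod>j\<in>S. (real (c j) / real n * s) ^ c j * t j ^ c j)"
      unfolding tp
    proof (rule prod.cong[OF refl])
      fix j assume "j \<in> S"
      then have "x j = (real (c j) / real n * s) * t j" using c0[of j] s n by (simp add: t_def)
      then show "x j ^ c j = (real (c j) / real n * s) ^ c j * t j ^ c j"
        by (metis power_mult_distrib)
    qed
    also have "\<dots> \<le> (\<Prod>j\<in>S. (real (c j) / real n * s) ^ c j * exp (real (c j) * (t j - 1)))"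
    proof (rule prod_mono, safe)
      fix j
      have t0: "0 \<le> t j" using x s by (simp add: t_def)
      have "t j \<le> exp (t j - 1)" using exp_ge_add_one_self[of "t j - 1"] by simp
      then have "t j ^ c j \<le> exp (t j - 1) ^ c j" using t0 by (rule power_mono)
      also have "\<dots> = exp (real (c j) * (t j - 1))" by (rule exp_of_nat_mult[symmetric])
      finally show "(real (c j) / real n * s) ^ c j * t j ^ c j
          \<le> (real (c j) / real n * s) ^ c j * exp (real (c j) * (t j - 1))"
        using s by (intro mult_left_mono) auto
      show "0 \<le> (real (c j) / real n * s) ^ c j * t j ^ c j" using t0 s by simp
    qed
    also have "\<dots> = (\<Prod>j\<in>S. (real (c j) / real n) ^ c j) * s ^ n * exp (\<Sum>j\<in>S. real (c j) * (t j - 1))"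
      by (simp only: prod.distrib power_mult_distrib power_sum[symmetric] sc exp_sum[OF S])
    also have "(\<Sum>j\<in>S. real (c j) * (t j - 1)) = (\<Sum>j\<in>S. real n / s * x j - real (c j))"
    proof (rule sum.cong[OF refl])
      fix j assume "j \<in> S"
      then have "real (c j) \<noteq> 0" using c0[of j] by simp
      then show "real (c j) * (t j - 1) = real n / s * x j - real (c j)"
        using s by (simp add: t_def field_simps)
    qed
    also have "\<dots> = real n / s * s - real (sum c S)"
      by (simp only: sum_subtractf sum_distrib_left[symmetric] s_sum[symmetric] of_nat_sum)
    also have "\<dots> = 0" using s by (simp add: sc)
    finally show ?thesis by (simp add: c_def s_def)
  qed
qed

text \<open>The effect of removing one element from a fibre or from the whole population, stated
  without division.\<close>

lemma ffact_Suc_left: "ffact k c * real (Suc k) = ffact (Suc k) c * (real (Suc k) - real c)"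
proof (induction c)
  case (Suc c)
  have "ffact k (Suc c) * real (Suc k) = (ffact k c * real (Suc k)) * (real k - real c)"
    by (simp add: ffact_def)
  also have "\<dots> = ffact (Suc k) (Suc c) * (real (Suc k) - real (Suc c))"
    unfolding Suc.IH by (simp add: ffact_def)
  finally show ?case .
qed (simp add: ffact_def)

text \<open>From the balanced fibre sizes \<open>q * c j\<close> one element at a time is removed from a fibre with
  maximal \<open>f j / c j\<close>, which never decreases the probability of the type \<open>c\<close>.\<close>

lemma ex_fibre_sizes:
  assumes S: "finite S" and c: "\<And>j. j \<in> S \<Longrightarrow> 0 < c j" and q: "0 < q"
    and N: "sum c S \<le> N" "N \<le> q * sum c S"
  shows "\<exists>f. (\<forall>j\<in>S. c j \<le> f j) \<and> sum f S = N \<and>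
    (\<Prod>j\<in>S. ffact (q * c j) (c j)) / ffact (q * sum c S) (sum c S)
      \<le> (\<Prod>j\<in>S. ffact (f j) (c j)) / ffact N (sum c S)"
  using N(2)
\<comment> \<open>Downward induction on the population size, starting at
  \<open>q * sum c S\<close>.\<close>
proof (induction rule: inc_induct)
  case base
  show ?case
    by (rule exI[of _ "\<lambda>j. q * c j"]) (use q in \<open>auto simp: sum_distrib_left\<close>)
next
  case (step M)
  let ?n = "sum c S"
  let ?R = "(\<Prod>j\<in>S. ffact (q * c j) (c j)) / ffact (q * ?n) ?n"
  obtain f where f: "\<And>j. j \<in> S \<Longrightarrow> c j \<le> f j" "sum f S = Suc M"
    "?R \<le> (\<Prod>j\<in>S. ffact (f j) (c j)) / ffact (Suc M) ?n"
    using step.IH by blast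
  have M: "?n \<le> M" using N(1) step.hyps by simp
  \<comment> \<open>Some colour is represented at least in proportion to \<open>c j\<close>, by
    comparing sums over \<open>S\<close>.\<close>
  have "\<exists>j\<in>S. c j * Suc M \<le> f j * ?n"
  proof (rule ccontr)
    assume "\<not> ?thesis"
    then have "f j * ?n < c j * Suc M" if "j \<in> S" for j
      using that by (metis not_less)
    moreover have "S \<noteq> {}" using f(2) by auto
    ultimately have "(\<Sum>j\<in>S. f j * ?n) < (\<Sum>j\<in>S. c j * Suc M)"
      using S by (intro sum_strict_mono) auto
    then show False
      by (simp only: f(2) sum_distrib_right[symmetric] mult.commute[of "Suc M"])
  qed
  then obtain j where j: "j \<in> S" "c j * Suc M \<le> f j * ?n" by blast
  \<comment> \<open>Strictness leaves at least \<open>c j\<close> elements in the fibre after the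
    removal.\<close>
  have cf: "c j < f j"
  proof -
    have "?n * c j \<le> M * c j" by (rule mult_le_mono1[OF M])
    also have "\<dots> < Suc M * c j" using c[OF j(1)] by simp
    also have "\<dots> = c j * Suc M" by (rule mult.commute)
    also have "\<dots> \<le> ?n * f j" using j(2) by (simp only: mult.commute)
    finally show ?thesis by simp
  qed
  then obtain k where k: "f j = Suc k" by (cases "f j") auto
  define f' where "f' = f(j := k)"
  have "sum f' (S - {j}) = sum f (S - {j})" by (rule sum.cong) (auto simp: f'_def)
  then have sum': "sum f' S = M" using f(2) k by (simp add: sum.remove[OF S j(1)] f'_def)
  have le': "\<forall>i\<in>S. c i \<le> f' i" using f(1) cf k by (simp add: f'_def)
  have "(\<Prod>i\<in>S - {j}. ffact (f' i) (c i)) = (\<Prod>i\<in>S - {j}. ffact (f i) (c i))"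
    by (rule prod.cong) (auto simp: f'_def)
  then have prod': "(\<Prod>i\<in>S. ffact (f' i) (c i)) * real (Suc k)
      = (\<Prod>i\<in>S. ffact (f i) (c i)) * (real (Suc k) - real (c j))"
    using ffact_Suc_left[of k "c j"] k by (simp add: prod.remove[OF S j(1)] f'_def mult_ac)
  let ?P = "\<Prod>i\<in>S. ffact (f i) (c i)" and ?P' = "\<Prod>i\<in>S. ffact (f' i) (c i)"
  have P0: "0 \<le> ?P" by (intro prod_nonneg ballI ffact_nonneg)
  have F: "0 < ffact M ?n" "0 < ffact (Suc M) ?n" using M by (auto intro!: ffact_pos)
  have "?P * ffact M ?n * (real (Suc k) * real (Suc M))
      = ?P * real (Suc k) * (ffact M ?n * real (Suc M))"
    by (simp only: mult_ac)
  also have "\<dots> = ?P * ffact (Suc M) ?n * (real (Suc k) * (real (Suc M) - real ?n))"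
    unfolding ffact_Suc_left by (simp only: mult_ac)
  \<comment> \<open>The removal multiplies the probability by \<open>1 - c j / Suc k\<close> and
    divides it by \<open>1 - ?n / Suc M\<close>; the choice of \<open>j\<close> makes the quotient
    at least one.\<close>
  also have "\<dots> \<le> ?P * ffact (Suc M) ?n * (real (Suc M) * (real (Suc k) - real (c j)))"
  proof (rule mult_left_mono)
    have "real (c j * Suc M) \<le> real (f j * ?n)" using j(2) by (simp only: of_nat_le_iff)
    then show "real (Suc k) * (real (Suc M) - real ?n) \<le> real (Suc M) * (real (Suc k) - real (c j))"
      unfolding k of_nat_mult by (simp only: right_diff_distrib mult_ac)
    show "0 \<le> ?P * ffact (Suc M) ?n" using P0 F by simp
  qed
  also have "\<dots> = ?P * (real (Suc k) - real (c j)) * (ffact (Suc M) ?n * real (Suc M))"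
    by (simp only: mult_ac)
  also have "\<dots> = ?P' * ffact (Suc M) ?n * (real (Suc k) * real (Suc M))"
    unfolding prod'[symmetric] by (simp only: mult_ac)
  finally have "?P * ffact M ?n \<le> ?P' * ffact (Suc M) ?n"
    by (rule mult_right_le_imp_le) simp
  then have "?P / ffact (Suc M) ?n \<le> ?P' / ffact M ?n"
    using F by (simp add: pos_divide_le_eq pos_le_divide_eq)
  then show ?case using f(3) sum' le' by (intro exI[of _ f'] conjI) auto
qed

text \<open>Identify \<open>A\<close> with a disjoint union of blocks of sizes \<open>f j\<close>
  and take the block index as colour.\<close>

lemma ex_map_with_fibre_sizes:
  assumes A: "finite A" and S: "finite S" and f: "sum f S = card A"
  shows "\<exists>x \<in> A \<rightarrow>\<^sub>E S. \<forall>j\<in>S. card {a \<in> A. x a = j} = f j"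
proof -
  have "card A = card (SIGMA j:S. {..<f j})" using S f by simp
  then obtain h where h: "bij_betw h A (SIGMA j:S. {..<f j})"
    using finite_same_card_bij[OF A] S by (metis finite_SigmaI finite_lessThan)
  have mem: "h a \<in> (SIGMA j:S. {..<f j})" if "a \<in> A" for a using h that by (auto simp: bij_betw_def)
  define x where "x = restrict (fst \<circ> h) A"
  have "x \<in> A \<rightarrow>\<^sub>E S" using mem by (fastforce simp: x_def)
  moreover have "card {a \<in> A. x a = j} = f j" if j: "j \<in> S" for j
  proof -
    have "h ` {a \<in> A. x a = j} = {p \<in> h ` A. fst p = j}"
      by (auto simp: x_def)
    also have "\<dots> = {j} \<times> {..<f j}" using h j by (auto simp: bij_betw_def)
    finally have "card (h ` {a \<in> A. x a = j}) = f j" by (simp add: card_cartesian_product)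
    moreover have "inj_on h {a \<in> A. x a = j}"
      using h by (auto simp: bij_betw_def intro: inj_on_subset)
    ultimately show ?thesis by (simp add: card_image)
  qed
  ultimately show ?thesis by blast
qed

section \<open>Exponential comparison of \<open>fratio\<close> along multiples of
  \<open>q\<close>\<close>

text \<open>The derivative of \<open>(1 - t) * exp t\<close> is \<open>- t * exp t\<close>; the
  proof replaces calculus by \<open>1 - b \<le> (1 - a) * (1 - (b - a))\<close>.\<close>

lemma one_minus_times_exp_antimono:
  fixes a b :: real
  assumes "0 \<le> a" "a \<le> b" "b \<le> 1"
  shows "(1 - b) * exp b \<le> (1 - a) * exp a"
proof -
  have "1 - b \<le> (1 - a) * (1 - (b - a))"
  proof -
    have "0 \<le> a * (b - a)" using assms by simp
    then show ?thesis by (simp add: algebra_simps)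
  qed
  also have "\<dots> \<le> (1 - a) * exp (a - b)"
  proof (rule mult_left_mono)
    show "1 - (b - a) \<le> exp (a - b)" using exp_ge_add_one_self[of "a - b"] by linarith
  qed (use assms in simp)
  finally have "(1 - b) * exp b \<le> (1 - a) * exp (a - b) * exp b"
    by (rule mult_right_mono) simp
  then show ?thesis by (simp add: mult.assoc flip: exp_add)
qed

text \<open>The factors are compared one by one, using \<open>i / n \<le> (i + 1) / (n + 1)\<close>.\<close>

lemma fratio_step:
  assumes q: "0 < q" and n: "0 < n"
  shows "fratio (q * Suc n) (Suc n) * exp (1 / (2 * real q)) \<le> fratio (q * n) n"
proof -
  define a where "a i = real i / real (q * n)" for i
  \<comment> \<open>The index is shifted because the factor of
    \<open>fratio (q * Suc n) (Suc n)\<close> at index zero equals \<open>1\<close>; both products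
    then have \<open>n\<close> factors.\<close>
  define b where "b i = real (Suc i) / real (q * Suc n)" for i
  have gauss: "(\<Sum>i<k. real i) = real k * (real k - 1) / 2" for k
    by (induction k) (auto simp: field_simps)
  have sa: "(\<Sum>i<n. a i) = (real n - 1) / (2 * real q)"
    using n q unfolding a_def sum_divide_distrib[symmetric] gauss by (simp add: field_simps)
  \<comment> \<open>The constant \<open>1 / (2 * q)\<close> is the difference between this sum and
    the sum of the \<open>a i\<close>.\<close>
  have sb: "(\<Sum>i<n. b i) = real n / (2 * real q)"
  proof -
    have "(\<Sum>i<n. b i) = (\<Sum>i<Suc n. real i) / real (q * Suc n)"
      unfolding b_def sum_divide_distrib[symmetric] sum.lessThan_Suc_shift by simp
    also have "\<dots> = (real (Suc n) * real n / 2) / (real q * real (Suc n))"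
      unfolding gauss by (simp only: of_nat_mult of_nat_Suc add_diff_cancel_left')
    also have "\<dots> = real n / (2 * real q)"
    proof -
      have cancel: "A * B / 2 / (Q * A) = B / (2 * Q)" if "A \<noteq> 0" for A B Q :: real
        using that by (simp add: field_simps)
      show ?thesis by (rule cancel) simp
    qed
    finally show ?thesis .
  qed
  have "fratio (q * Suc n) (Suc n) = (\<Prod>i<n. 1 - b i)"
    unfolding fratio_def b_def prod.lessThan_Suc_shift by simp
  then have "fratio (q * Suc n) (Suc n) * exp (\<Sum>i<n. b i) = (\<Prod>i<n. (1 - b i) * exp (b i))"
    by (simp add: exp_sum prod.distrib)
  also have "\<dots> \<le> (\<Prod>i<n. (1 - a i) * exp (a i))"
  proof (rule prod_mono, safe)
    fix i assume i: "i < n"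
    have q1: "1 \<le> real q" using q by simp
    have "real (Suc i) \<le> real (Suc n)" using i by simp
    also have "\<dots> \<le> real q * real (Suc n)" using q1 by (simp del: of_nat_Suc)
    finally have b1: "b i \<le> 1" by (simp add: b_def divide_le_eq distrib_left)
    have "real i * real (Suc n) \<le> real (Suc i) * real n" using i by (simp add: algebra_simps)
    then have "real i / real n \<le> real (Suc i) / real (Suc n)"
      using n by (simp add: pos_divide_le_eq pos_le_divide_eq del: of_nat_Suc)
    from divide_right_mono[OF this, of "real q"] have ab: "a i \<le> b i"
      by (simp only: a_def b_def of_nat_mult divide_divide_eq_left mult.commute)
    show "(1 - b i) * exp (b i) \<le> (1 - a i) * exp (a i)"
      using ab b1 by (intro one_minus_times_exp_antimono) (auto simp: a_def)
    show "0 \<le> (1 - b i) * exp (b i)" using b1 by simp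
  qed
  also have "\<dots> = fratio (q * n) n * exp (\<Sum>i<n. a i)"
    by (simp add: fratio_def a_def exp_sum prod.distrib)
  finally have "fratio (q * Suc n) (Suc n) * exp (real n / (2 * real q)) * exp (- ((real n - 1) / (2 * real q)))
      \<le> fratio (q * n) n * exp ((real n - 1) / (2 * real q)) * exp (- ((real n - 1) / (2 * real q)))"
    unfolding sa sb by (rule mult_right_mono) simp
  moreover have "real n / (2 * real q) + - ((real n - 1) / (2 * real q)) = 1 / (2 * real q)"
    by (simp add: diff_divide_distrib)
  ultimately show ?thesis by (simp only: mult.assoc exp_add[symmetric]) simp
qed

lemma fratio_iterate:
  assumes q: "0 < q" and n: "0 < n"
  shows "fratio (q * (n + d)) (n + d) * exp (real d / (2 * real q)) \<le> fratio (q * n) n"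
proof (induction d)
  case (Suc d)
  have "fratio (q * (n + Suc d)) (n + Suc d) * exp (real (Suc d) / (2 * real q))
      = fratio (q * Suc (n + d)) (Suc (n + d)) * exp (1 / (2 * real q)) * exp (real d / (2 * real q))"
    by (simp add: mult.assoc add_divide_distrib flip: exp_add)
  also have "\<dots> \<le> fratio (q * (n + d)) (n + d) * exp (real d / (2 * real q))"
    using q n by (intro mult_right_mono fratio_step) auto
  finally show ?case using Suc by simp
qed simp

text \<open>Evaluate at one word of type \<open>c\<close>, pass from \<open>N\<close> to the
  balanced population \<open>q * n\<close> by \<open>ex_fibre_sizes\<close>, and compare the two
  remaining \<open>fratio\<close> values by \<open>fratio_iterate\<close>.\<close>

lemma pis_norm_mu_lower:
  assumes m: "1 \<le> m" "m \<le> n" and N: "n \<le> N" "N \<le> q * n"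
  shows "\<exists>x \<in> {1..N} \<rightarrow>\<^sub>E {1..m}. exp ((real m - 1) / (2 * real q)) \<le> pis_norm {1..m} n (mu n N x)"
proof -
  let ?S = "{1..m}"
  have q: "0 < q" using m N by (cases q) auto
  \<comment> \<open>The letter 1 occurs \<open>n - m + 1\<close> times and every other letter once.
    A single draw has \<open>fratio\<close> equal to one, so only the letter 1 contributes a
    factor.\<close>
  define ys where "ys = replicate (n - m) 1 @ [1..<m+1]"
  define c where "c = count_list ys"
  have len: "length ys = n" using m by (simp add: ys_def)
  have w: "ys \<in> words ?S n" using m len by (auto simp: words_def ys_def)
  have cj: "c j = (if j = 1 then n - m + 1 else 1)" if "j \<in> ?S" for j
  proof -
    have "count_list us j = (if j \<in> set us then 1 else 0)" if "distinct us" for us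
      using that by (induction us) auto
    then have "count_list [1..<m+1] j = 1" using that by simp
    moreover have "count_list (replicate k (1::nat)) j = (if j = 1 then k else 0)" for k
      by (induction k) auto
    ultimately show ?thesis by (simp add: c_def ys_def)
  qed
  have c0: "0 < c j" if "j \<in> ?S" for j using cj[OF that] by simp
  have sc: "sum c ?S = n"
    using sum_count_set[of ys ?S] w len by (simp add: c_def words_def)
  obtain f where f: "sum f ?S = N"
    "(\<Prod>j\<in>?S. ffact (q * c j) (c j)) / ffact (q * n) n \<le> (\<Prod>j\<in>?S. ffact (f j) (c j)) / ffact N n"
    using ex_fibre_sizes[of ?S c q N] c0 q N by (auto simp: sc)
  obtain x where x: "x \<in> {1..N} \<rightarrow>\<^sub>E ?S" "\<forall>j\<in>?S. card {i \<in> {1..N}. x i = j} = f j"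
    using ex_map_with_fibre_sizes[of "{1..N}" ?S f] f(1) by auto
  have xS: "x ` {1..N} \<subseteq> ?S" using x(1) by auto
  let ?b = "\<Prod>j\<in>?S. (real (c j) / real n) ^ c j"
  have b0: "0 < ?b" using c0 m by (intro prod_pos) auto
  have mu: "mu n N x ys = (\<Prod>j\<in>?S. ffact (f j) (c j)) / ffact N n"
    using x(2) by (simp add: mu_eq[OF _ N(1) w] c_def)
  \<comment> \<open>Supplies representability, so that the infimum defining the norm runs over a
    nonempty set.\<close>
  have "pis_le ?S n (mu n N x) (kappa n * (\<Sum>ys\<in>words ?S n. \<bar>mu n N x ys\<bar>))"
    using xS N by (intro pis_le_symmetric mu_in_tspace symmetric_tensor_mu[where S = ?S]) auto
  then have ne: "pis_sums ?S n (mu n N x) \<noteq> {}" by (simp add: pis_le_def)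
  have lower: "mu n N x ys / ?b \<le> pis_norm ?S n (mu n N x)"
    using ne b0
  proof (rule pis_norm_point_lower)
    show "tpow ?S n y ys \<le> ?b * l1norm ?S y ^ n" if "\<And>s. 0 \<le> y s" for y
      using tpow_le[OF _ w _ _ that] c0 m unfolding c_def by simp
  qed
  have base: "(\<Prod>j\<in>?S. ffact (q * c j) (c j)) / ffact (q * n) n
      = ?b * (fratio (q * (n - m + 1)) (n - m + 1) / fratio (q * n) n)"
  proof -
    have "(\<Prod>j\<in>?S. ffact (q * c j) (c j)) = (\<Prod>j\<in>?S. real (q * c j) ^ c j * fratio (q * c j) (c j))"
      using c0 q by (intro prod.cong) (auto simp: ffact_eq_fratio)
    also have "\<dots> = (\<Prod>j\<in>?S. real (q * c j) ^ c j) * (\<Prod>j\<in>?S. fratio (q * c j) (c j))"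
      by (rule prod.distrib)
    also have "(\<Prod>j\<in>?S. fratio (q * c j) (c j)) = fratio (q * (n - m + 1)) (n - m + 1)"
    proof -
      have "(\<Prod>j\<in>?S - {1}. fratio (q * c j) (c j)) = 1"
        by (rule prod.neutral) (auto simp: cj fratio_def)
      then show ?thesis using m by (subst prod.remove[of _ 1]) (auto simp: cj)
    qed
    \<comment> \<open>Since \<open>q * c j\<close> is \<open>c j / n\<close> times
      \<open>q * n\<close>, the powers of \<open>q * n\<close> cancel against the denominator and
      leave exactly \<open>?b\<close>.\<close>
    also have "(\<Prod>j\<in>?S. real (q * c j) ^ c j) = (\<Prod>j\<in>?S. (real (c j) / real n) ^ c j * real (q * n) ^ c j)"
      using m by (intro prod.cong refl) (simp add: power_mult_distrib[symmetric] mult.commute)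
    also have "\<dots> = ?b * real (q * n) ^ n"
      by (simp add: prod.distrib flip: power_sum sc)
    finally have "(\<Prod>j\<in>?S. ffact (q * c j) (c j)) = ?b * real (q * n) ^ n * fratio (q * (n - m + 1)) (n - m + 1)" .
    moreover have "ffact (q * n) n = real (q * n) ^ n * fratio (q * n) n"
      using q m by (intro ffact_eq_fratio) auto
    moreover have "real (q * n) ^ n \<noteq> 0" using q m by simp
    moreover have "B * X * F / (X * G) = B * (F / G)" if "X \<noteq> 0" for B X F G :: real
      using that by simp
    ultimately show ?thesis by (simp only:)
  qed
  have "exp ((real m - 1) / (2 * real q)) \<le> fratio (q * (n - m + 1)) (n - m + 1) / fratio (q * n) n"
  proof -
    have "fratio (q * n) n * exp ((real m - 1) / (2 * real q)) \<le> fratio (q * (n - m + 1)) (n - m + 1)"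
      \<comment> \<open>Climbing from \<open>n - m + 1\<close> to \<open>n\<close> takes
        \<open>m - 1\<close> steps, which gives the numerator of the exponent.\<close>
      using fratio_iterate[OF q, of "n - m + 1" "m - 1"] m by (simp add: of_nat_diff)
    moreover have "0 < fratio (q * n) n" using q by (intro fratio_pos) simp
    ultimately show ?thesis by (simp add: pos_le_divide_eq mult.commute)
  qed
  also have "\<dots> = (\<Prod>j\<in>?S. ffact (q * c j) (c j)) / ffact (q * n) n / ?b"
    unfolding base by (rule nonzero_mult_div_cancel_left[symmetric]) (use b0 in linarith)
  also have "\<dots> \<le> mu n N x ys / ?b"
    unfolding mu using f(2) b0 by (intro divide_right_mono) auto
  also note lower
  finally show ?thesis using x(1) by blast
qed

section \<open>The four estimates\<close>

text \<open>Contractivity under push-forward; this transfers the lower bound for colourings to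
  \<open>kappa2\<close>.\<close>

lemma pis_norm_mu_le_kappa2:
  fixes x :: "nat \<Rightarrow> nat"
  assumes "x \<in> {1..N} \<rightarrow>\<^sub>E {1..m}" "n \<le> N"
  shows "pis_norm {1..m} n (mu n N x) \<le> kappa2 n N"
proof -
  have id: "chi n N = mu n N id" by (simp add: chi_def mu_def)
  have "pis_le {1..N} n (chi n N) (kappa n * (\<Sum>ys\<in>words {1..N} n. \<bar>chi n N ys\<bar>))"
    unfolding id using assms
    by (intro pis_le_symmetric mu_in_tspace symmetric_tensor_mu[where S = "{1..N}"]) auto
  then have "pis_le {1..N} n (chi n N) (kappa2 n N)"
    unfolding kappa2_def by (rule pis_le_self)
  then have "pis_le {1..m} n (push x {1..N} n (chi n N)) (kappa2 n N)"
    using assms(1) by (intro pis_le_push) auto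
  then show ?thesis
    unfolding mu_eq_push[OF assms(2)] by (rule pis_le_norm)
qed

text \<open>Conditioning an independent uniform sample on having no coincidence gives \<open>chi\<close>.\<close>

lemma kappa2_upper:
  assumes n: "n \<le> N" "0 < N" and N: "real N > real n * (real n - 1) / 2"
  shows "kappa2 n N \<le> 1 + real n * (real n - 1) / (2 * real N - real n * (real n - 1)) * (kappa n + 1)"
proof -
  let ?S = "{1..N}"
  \<comment> \<open>The probability that \<open>n\<close> independent uniform draws show no
    coincidence.\<close>
  define p where "p = fratio N n"
  define u where "u s = (if s \<in> ?S then 1 / real N else 0)" for s :: nat
  define r where "r = 1 / real N ^ n"
  \<comment> \<open>The part of the independent law carried by words with a coincidence: symmetric,
    of mass \<open>1 - p\<close>. Subtracting it and dividing by \<open>p\<close> is the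
    conditioning.\<close>
  define V where "V ys = (if ys \<in> words ?S n \<and> \<not> distinct ys then r else 0)" for ys :: "nat list"
  have p0: "0 < p" using n by (simp add: p_def fratio_pos)
  have r0: "0 < r" using n by (simp add: r_def)
  have ff: "ffact N n = p / r" using n by (simp add: ffact_eq_fratio p_def r_def)
  have tu: "tpow ?S n u ys = (if ys \<in> words ?S n then r else 0)" for ys
  proof -
    have "prod_list (map u ys) = (1 / real N) ^ length ys" if "set ys \<subseteq> ?S" for ys
      using that by (induction ys) (auto simp: u_def)
    then show ?thesis by (auto simp: tpow_eq words_def r_def power_divide)
  qed
  have chi: "chi n N = (\<lambda>ys. (1 / p) * tpow ?S n u ys + (- (1 / p)) * V ys)"
  proof
    fix ys show "chi n N ys = (1 / p) * tpow ?S n u ys + (- (1 / p)) * V ys"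
      using p0 r0 by (auto simp: chi_eq[OF n(1)] tu V_def ff distinct_words_def)
  qed
  have "l1norm ?S u = 1" using n by (simp add: l1norm_def u_def)
  moreover have "u \<in> l1 ?S" by (auto simp: l1_def u_def)
  moreover have "0 \<le> u s" for s by (simp add: u_def)
  ultimately have U: "pis_le ?S n (tpow ?S n u) 1"
    using pis_leI[OF pis_sums_tpow, of u ?S n 1] by simp
  have sumV: "(\<Sum>ys\<in>words ?S n. \<bar>V ys\<bar>) = 1 - p"
  proof -
    have "(\<Sum>ys\<in>words ?S n. \<bar>V ys\<bar>) = (\<Sum>ys\<in>words ?S n. tpow ?S n u ys - (if distinct ys then r else 0))"
      using r0 by (intro sum.cong refl) (auto simp: V_def tu)
    also have "\<dots> = real (card (words ?S n)) * r - (\<Sum>ys\<in>distinct_words ?S n. r)"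
      unfolding sum_subtractf distinct_words_def
      by (subst sum.inter_filter) (auto simp: tu)
    also have "\<dots> = real (card (words ?S n)) * r - p"
      using card_distinct_words[of ?S n] r0 by (simp add: ff)
    also have "card (words ?S n) = N ^ n"
      using card_lists_length_eq[of ?S n] by (simp add: words_def conj_commute)
    also have "real (N ^ n) * r = 1" using n by (simp add: r_def)
    finally show ?thesis .
  qed
  have "V \<in> tspace ?S n" by (auto simp: tspace_def V_def words_def)
  moreover have "symmetric_tensor n V"
  proof -
    have "distinct (permute_list \<sigma> ys) = distinct ys" if "\<sigma> permutes {..<length ys}" for \<sigma> and ys :: "nat list"
      using mset_eq_imp_distinct_iff[OF mset_permute_list[OF that]] .
    then show ?thesis by (auto simp: symmetric_tensor_permute_list V_def words_def)
  qed
  ultimately have "pis_le ?S n V (kappa n * (1 - p))"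
    using pis_le_symmetric[of ?S V n] by (simp add: sumV)
  then have "pis_le ?S n (chi n N) (\<bar>1 / p\<bar> * 1 + \<bar>- (1 / p)\<bar> * (kappa n * (1 - p)))"
    unfolding chi by (intro pis_le_add pis_le_scale U)
  then have "kappa2 n N \<le> \<bar>1 / p\<bar> * 1 + \<bar>- (1 / p)\<bar> * (kappa n * (1 - p))"
    unfolding kappa2_def by (rule pis_le_norm)
  also have "\<dots> = 1 + (1 - p) / p * (kappa n + 1)"
    using p0 by (simp add: field_simps)
  also have "\<dots> \<le> 1 + real n * (real n - 1) / (2 * real N - real n * (real n - 1)) * (kappa n + 1)"
  proof -
    define e where "e = real n * (real n - 1)"
    have gauss: "(\<Sum>i<n. real i) = e / 2"
      unfolding e_def by (induction n) (auto simp: field_simps)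
    \<comment> \<open>The Weierstrass inequality in the role of the birthday union bound.\<close>
    have "1 - (\<Sum>i<n. real i / real N) \<le> p"
      unfolding p_def fratio_def
      by (rule Weierstrass_prod_ineq) (use n in auto)
    then have "1 - e / (2 * real N) \<le> p"
      by (simp add: sum_divide_distrib[symmetric] gauss)
    then have "2 * real N - e \<le> 2 * real N * p" using n by (simp add: field_simps)
    moreover have "0 < 2 * real N - e" using N by (simp add: e_def)
    ultimately have "(1 - p) / p \<le> e / (2 * real N - e)"
      using p0 by (simp add: divide_le_eq pos_le_divide_eq field_simps)
    then show ?thesis
      unfolding e_def by (intro add_left_mono mult_right_mono) (use kappa_nonneg[of n] in auto)
  qed
  finally show ?thesis .
qed

theorem theorem7p12:
  fixes n :: nat
  assumes "n \<ge> 1"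
  shows
   "(\<forall>N::nat. real N > real n * (real n - 1) / 2 \<longrightarrow>
       kappa2 n N \<le> 1 + real n * (real n - 1) / (2 * real N - real n * (real n - 1)) * (kappa n + 1))
  \<and> (\<forall>N::nat. N \<ge> n \<longrightarrow>
       kappa2 n N \<ge> exp ((real n - 1) / (2 * real_of_int \<lceil>real N / real n\<rceil>)) \<and>
       exp ((real n - 1) / (2 * real_of_int \<lceil>real N / real n\<rceil>)) \<ge> 1 + real n * (real n - 1) / (2 * (real N + real n)))
  \<and> (\<forall>N m::nat. N \<ge> n \<and> n \<ge> m \<and> m \<ge> 1 \<longrightarrow>
       kappa3 n N m \<le> 1 + c_pis n {1..m} * (2 * real m * real n / real N) \<and>
       1 + c_pis n {1..m} * (2 * real m * real n / real N) \<le> 1 + 2 * real m * real n * kappa n / real N)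
  \<and> (\<forall>N m::nat. N \<ge> n \<and> n \<ge> m \<and> m \<ge> 1 \<longrightarrow>
       kappa3 n N m \<ge> exp ((real m - 1) / (2 * real_of_int \<lceil>real N / real n\<rceil>)) \<and>
       exp ((real m - 1) / (2 * real_of_int \<lceil>real N / real n\<rceil>)) \<ge> 1 + (real m - 1) * real n / (2 * (real N + real n)))"
proof -
  have fin: "finite ({1..N} \<rightarrow>\<^sub>E {1..m})" for N m :: nat by (intro finite_PiE) auto
  have i: "kappa2 n N \<le> 1 + real n * (real n - 1) / (2 * real N - real n * (real n - 1)) * (kappa n + 1)"
    if N: "real N > real n * (real n - 1) / 2" for N
  proof (rule kappa2_upper[OF _ _ N])
    \<comment> \<open>This gives \<open>n - 1 \<le> n * (n - 1) / 2 < N\<close>, hence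
      \<open>n \<le> N\<close>, which \<open>kappa2_upper\<close> requires.\<close>
    have "0 \<le> (real n - 1) * (real n - 2)"
      using assms by (cases "n = 1") auto
    then have "real n - 1 \<le> real n * (real n - 1) / 2" by (simp add: algebra_simps)
    then show "n \<le> N" "0 < N" using N assms by linarith+
  qed
  have lower: "\<exists>x \<in> {1..N} \<rightarrow>\<^sub>E {1..m}. exp ((real m - 1) / (2 * real_of_int \<lceil>real N / real n\<rceil>)) \<le> pis_norm {1..m} n (mu n N x)"
    and elem: "exp ((real m - 1) / (2 * real_of_int \<lceil>real N / real n\<rceil>)) \<ge> 1 + (real m - 1) * real n / (2 * (real N + real n))"
    if mN: "n \<le> N" "m \<le> n" "1 \<le> m" for N m
  proof -
    \<comment> \<open>The least \<open>q\<close> with \<open>N \<le> q * n\<close>, so the bound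
      from \<open>pis_norm_mu_lower\<close> is strongest.\<close>
    define q where "q = nat \<lceil>real N / real n\<rceil>"
    have pos: "0 < real N / real n" using assms mN by simp
    then have q: "real_of_int \<lceil>real N / real n\<rceil> = real q" by (simp add: q_def)
    have "real N / real n \<le> real q" using q le_of_int_ceiling[of "real N / real n"] by simp
    then have "real N \<le> real (q * n)" using assms by (simp add: pos_divide_le_eq)
    then have "N \<le> q * n" by (simp only: of_nat_le_iff)
    then show "\<exists>x \<in> {1..N} \<rightarrow>\<^sub>E {1..m}. exp ((real m - 1) / (2 * real_of_int \<lceil>real N / real n\<rceil>)) \<le> pis_norm {1..m} n (mu n N x)"
      unfolding q using mN by (intro pis_norm_mu_lower)
    have q0: "0 < real q" using pos \<open>real N / real n \<le> real q\<close> by linarith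
    \<comment> \<open>Rounding up adds less than one, so \<open>q * n \<le> N + n\<close>; the
      elementary bound then follows from \<open>1 + t \<le> exp t\<close>.\<close>
    have "real q < real N / real n + 1" using q ceiling_correct[of "real N / real n"] by linarith
    then have "real q * real n \<le> real N + real n" using assms by (simp add: field_simps)
    then have "(real m - 1) * (real q * real n) \<le> (real m - 1) * (real N + real n)"
      using mN by (intro mult_left_mono) auto
    then have "(real m - 1) * real n / (2 * (real N + real n)) \<le> (real m - 1) / (2 * real q)"
      using q0 assms by (simp add: field_simps)
    then show "exp ((real m - 1) / (2 * real_of_int \<lceil>real N / real n\<rceil>)) \<ge> 1 + (real m - 1) * real n / (2 * (real N + real n))"
      unfolding q using exp_ge_add_one_self[of "(real m - 1) / (2 * real q)"] by linarith
  qed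
  have ii: "kappa2 n N \<ge> exp ((real n - 1) / (2 * real_of_int \<lceil>real N / real n\<rceil>))" if "n \<le> N" for N
  proof -
    note nN = that
    \<comment> \<open>The case \<open>m = n\<close>, where the chosen word uses every letter exactly
      once.\<close>
    obtain x where "x \<in> {1..N} \<rightarrow>\<^sub>E {1..n}"
      "exp ((real n - 1) / (2 * real_of_int \<lceil>real N / real n\<rceil>)) \<le> pis_norm {1..n} n (mu n N x)"
      using lower[OF nN order_refl assms] by blast
    then show ?thesis using pis_norm_mu_le_kappa2[OF _ nN] order_trans by blast
  qed
  have iii: "kappa3 n N m \<le> 1 + c_pis n {1..m} * (2 * real m * real n / real N)"
    if mN: "n \<le> N" "m \<le> n" "1 \<le> m" for N m
  proof -
    have "pis_norm {1..m} n (mu n N x) \<le> 1 + c_pis n {1..m} * (2 * real m * real n / real N)"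
      if "x \<in> {1..N} \<rightarrow>\<^sub>E {1..m}" for x
      using pis_norm_mu_le[of "{1..m}" x N n] that mN by auto
    moreover have "{1..N} \<rightarrow>\<^sub>E {1..m} \<noteq> {}" using mN by (simp add: PiE_eq_empty_iff)
    ultimately show ?thesis
      unfolding kappa3_def using fin by (subst Max_le_iff) auto
  qed
  have iii': "1 + c_pis n {1..m} * (2 * real m * real n / real N) \<le> 1 + 2 * real m * real n * kappa n / real N"
    if "1 \<le> m" for N m
  proof -
    have "c_pis n {1..m} * (2 * real m * real n / real N) \<le> kappa n * (2 * real m * real n / real N)"
      using that by (intro mult_right_mono c_pis_le_kappa) auto
    then show ?thesis by (simp add: mult_ac)
  qed
  have iv: "kappa3 n N m \<ge> exp ((real m - 1) / (2 * real_of_int \<lceil>real N / real n\<rceil>))"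
    if mN: "n \<le> N" "m \<le> n" "1 \<le> m" for N m
  proof -
    obtain x where x: "x \<in> {1..N} \<rightarrow>\<^sub>E {1..m}"
      "exp ((real m - 1) / (2 * real_of_int \<lceil>real N / real n\<rceil>)) \<le> pis_norm {1..m} n (mu n N x)"
      using lower[OF mN] by blast
    have "pis_norm {1..m} n (mu n N x) \<le> kappa3 n N m"
      unfolding kappa3_def using fin x(1) by (intro Max_ge) auto
    then show ?thesis using x(2) by linarith
  qed
  show ?thesis
    using i ii elem[OF _ order_refl assms] iii iii' iv elem by (simp add: mult.commute[of "real n"])
qed

end
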